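(* Let $\lambda=(\lambda_1,\dots,\lambda_n)$ be a partition with positive parts and $m=\lambda_1$. Then the $m+n-1$ polynomials $$\sum_{i\ge1,\ k+i\le\lambda_i} x_iy_{k+i}\quad(k=0,\dots,m-1),\qquad \sum_{i\ge1,\ k+i\le n,\ i\le\lambda_{k+i}} x_{k+i}y_i\quad(k=1,\dots,n-1)$$ (the "diagonals" of the Ferrers tableau, each summand being a monomial generator of $I_\lambda$) generate a minimal reduction $J_\lambda$ of the Ferrers ideal $I_\lambda$.
   Context: Let $K$ be a field. For a partition $\lambda=(\lambda_1\ge\cdots\ge\lambda_n)$ with positive parts and $m=\lambda_1$, the Ferrers ideal is $I_\lambda=(x_iy_j:1\le i\le n,\ 1\le j\le\lambda_i)\subset K[x_1,\dots,x_n,y_1,\dots,y_m]$. An ideal $J\subset I$ is a reduction of $I$ if $I^{r+1}=JI^r$ for some $r\ge0$; it is a minimal reduction if no ideal strictly contained in $J$ is a reduction of $I$. *)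

theory Defs
  imports "HOL-Algebra.Ideal_Product" "HOL-Library.Poly_Mapping"
begin

(* Polynomials over a coefficient ring 'a in variables of type 'v:
   finitely supported maps from monomials (exponent vectors 'v =>0 nat) to 'a. *)

definition poly_ring_on :: "'v set \<Rightarrow> ((('v \<Rightarrow>\<^sub>0 nat) \<Rightarrow>\<^sub>0 'a::comm_ring_1) ring)" where
  "poly_ring_on V =
     \<lparr> carrier = {p. \<forall>\<mu>\<in>Poly_Mapping.keys p. Poly_Mapping.keys \<mu> \<subseteq> V},
       mult = (*), one = 1, zero = 0, add = (+) \<rparr>"

text \<open>Variables: Inl i is x_i, Inr j is y_j.\<close>
definition xy :: "nat \<Rightarrow> nat \<Rightarrow> (((nat + nat) \<Rightarrow>\<^sub>0 nat) \<Rightarrow>\<^sub>0 'a::comm_ring_1)" where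
  "xy i j = Poly_Mapping.single
              (Poly_Mapping.single (Inl i) 1 + Poly_Mapping.single (Inr j) 1) 1"

text \<open>A partition lambda = (lambda_1 >= ... >= lambda_n) with positive parts, as a list;
  lambda_i = lam ! (i - 1), n = length lam, m = lambda_1 = hd lam.\<close>
definition is_partition :: "nat list \<Rightarrow> bool" where
  "is_partition lam \<longleftrightarrow> lam \<noteq> [] \<and> sorted_wrt (\<ge>) lam \<and> (\<forall>p\<in>set lam. 0 < p)"

definition part :: "nat list \<Rightarrow> nat \<Rightarrow> nat" where
  "part lam i = lam ! (i - 1)"

definition ferrers_ring :: "nat list \<Rightarrow> ((((nat + nat) \<Rightarrow>\<^sub>0 nat) \<Rightarrow>\<^sub>0 'a::comm_ring_1) ring)" where
  "ferrers_ring lam = poly_ring_on (Inl ` {1..length lam} \<union> Inr ` {1..hd lam})"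

definition ferrers_ideal :: "nat list \<Rightarrow> (((nat + nat) \<Rightarrow>\<^sub>0 nat) \<Rightarrow>\<^sub>0 'a::comm_ring_1) set" where
  "ferrers_ideal lam = genideal (ferrers_ring lam)
     {xy i j | i j. 1 \<le> i \<and> i \<le> length lam \<and> 1 \<le> j \<and> j \<le> part lam i}"

definition ferrers_diagonals :: "nat list \<Rightarrow> (((nat + nat) \<Rightarrow>\<^sub>0 nat) \<Rightarrow>\<^sub>0 'a::comm_ring_1) set" where
  "ferrers_diagonals lam =
     {(\<Sum>i\<in>{i. 1 \<le> i \<and> i \<le> length lam \<and> k + i \<le> part lam i}. xy i (k + i)) | k. k \<le> hd lam - 1}
   \<union> {(\<Sum>i\<in>{i. 1 \<le> i \<and> k + i \<le> length lam \<and> i \<le> part lam (k + i)}. xy (k + i) i) | k.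
        1 \<le> k \<and> k \<le> length lam - 1}"

definition diagonal_ideal :: "nat list \<Rightarrow> (((nat + nat) \<Rightarrow>\<^sub>0 nat) \<Rightarrow>\<^sub>0 'a::comm_ring_1) set" where
  "diagonal_ideal lam = genideal (ferrers_ring lam) (ferrers_diagonals lam)"

fun ideal_pow :: "('a, 'b) ring_scheme \<Rightarrow> 'a set \<Rightarrow> nat \<Rightarrow> 'a set" where
  "ideal_pow R I 0 = carrier R"
| "ideal_pow R I (Suc k) = ideal_prod R I (ideal_pow R I k)"

definition is_reduction :: "('a, 'b) ring_scheme \<Rightarrow> 'a set \<Rightarrow> 'a set \<Rightarrow> bool" where
  "is_reduction R J I \<longleftrightarrow> ideal J R \<and> J \<subseteq> I \<and>
     (\<exists>r. ideal_pow R I (Suc r) = ideal_prod R J (ideal_pow R I r))"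

definition is_minimal_reduction :: "('a, 'b) ring_scheme \<Rightarrow> 'a set \<Rightarrow> 'a set \<Rightarrow> bool" where
  "is_minimal_reduction R J I \<longleftrightarrow> is_reduction R J I \<and>
     \<not> (\<exists>J'. J' \<subset> J \<and> is_reduction R J' I)"

end

theory Submission
  imports Defs "HOL-Computational_Algebra.Polynomial_FPS"
begin

text \<open>
  \<^emph>\<open>Reduction.\<close> Two distinct generators on the same diagonal multiply to a product of two generators one
  of which lies on a higher diagonal. Hence modulo \<open>J\<close>, the square of a generator is a combination of
  multiples of generators on higher diagonals, and by descending induction all generators are nilpotent
  in \<open>\<Oplus> I^a / J I^(a-1)\<close>.

  \<^emph>\<open>Minimality.\<close> A reduction properly contained in \<open>J\<close> lies in a maximal one, \<open>K\<close>, and \<open>J/K = R/Q\<close> for a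
  maximal ideal \<open>Q\<close>, which gives a linear form \<open>\<phi> : J \<rightarrow> R/Q\<close> that vanishes on \<open>K\<close>. Near the point of \<open>Q\<close>,
  the ideal \<open>I\<close> is generated by some of the variables and the Ferrers ideal of a smaller diagram. Since
  the diagonals of the latter can be prescribed freely near a suitable point, there is a family
  of arcs, parametrised by \<open>\<tau>\<close>, along which the leading coefficients of the diagonals \<open>d\<close> are
  \<open>\<tau> \<phi> d + (1 - \<tau>) e\<close> with constant \<open>e\<close>. Those of elements of \<open>K\<close> are then divisible
  by \<open>1 - \<tau>\<close>, and those of \<open>J\<close> are not, so \<open>I^(r+1) = K I^r\<close> contradicts Nakayama's lemma at \<open>\<tau> = 1\<close>.
\<close>

subsection \<open>Products of generators\<close>

text \<open>The ideals that compete with \<open>J\<close> need not be homogeneous, so counting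
  generators at the origin is not enough: \<open>Q\<close> may be any maximal ideal containing
  \<open>I\<close>, and there the diagonals can be redundant generators of \<open>J\<close>. A
  single arc along which \<open>J\<close> has the same order as \<open>I\<close>, and
  \<open>K\<close> a higher one, would contradict I^(r+1) = K I^r at once. Its leading coefficients
  would have to solve quadratic equations over R/Q, which need not be solvable: for a 2 by 2 square
  with diagonals B, A, C, the product z = x_1 y_1 satisfies z^2 - A z + B C = 0. Near a point with
  invertible Jacobian they are solvable formally. Hence the path from e to \<phi> d: its lift is a
  power series in \<tau>, which has no value at \<tau> = 1. What can be evaluated at 1 are the
  relations between the leading coefficients of I^r, since their coefficients are polynomials in
  \<tau>. Nakayama's lemma turns them into one polynomial, with value at 1 outside \<open>Q\<close>,
  that kills all these leading coefficients modulo \<open>Q\<close>. Such a polynomial is also a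
  nonzero power series modulo \<open>Q\<close>, so they all vanish, although that of d^r for a
  suitable diagonal d does not.\<close>

interpretation idl: module "(*) :: 'p::comm_ring_1 \<Rightarrow> 'p \<Rightarrow> 'p"
  by unfold_locales (simp_all add: algebra_simps)

(* As a simp rule, the module law a * (b * x) = (a * b) * x loops with mult.assoc. *)
declare idl.scale_scale [simp del]

fun pow_gens :: "'p::comm_ring_1 set \<Rightarrow> nat \<Rightarrow> 'p set" where
  "pow_gens G 0 = {1}"
| "pow_gens G (Suc r) = {g * h | g h. g \<in> G \<and> h \<in> pow_gens G r}"

definition prods :: "'p::comm_ring_1 set \<Rightarrow> 'p set \<Rightarrow> 'p set" where
  "prods A B = {a * b | a b. a \<in> A \<and> b \<in> B}"

lemma prodsI: "a \<in> A \<Longrightarrow> b \<in> B \<Longrightarrow> a * b \<in> prods A B"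
  by (auto simp: prods_def)

lemma prods_mono: "A \<subseteq> A' \<Longrightarrow> prods A B \<subseteq> prods A' B"
  by (auto simp: prods_def)

text \<open>The ring is a module over itself, so \<open>idl.span\<close> is the ideal generated by a
  set and \<open>idl.subspace\<close> means being an ideal. Inclusions between products of ideals
  are thereby checked on generators.\<close>

lemma span_times:
  assumes "x \<in> idl.span A" "y \<in> idl.span B" "\<And>a b. a \<in> A \<Longrightarrow> b \<in> B \<Longrightarrow> a * b \<in> idl.span C"
  shows "x * y \<in> idl.span C"
  using assms(1)
proof (induction rule: idl.span_induct_alt)
  case base
  show ?case by (simp add: idl.span_zero)
next
  case (step c a x)
  have "a * y \<in> idl.span C"
    using assms(2)
  proof (induction rule: idl.span_induct_alt)
    case base
    show ?case by (simp add: idl.span_zero)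
  next
    case (step c' b y)
    have "a * (c' * b + y) = c' * (a * b) + a * y" by (simp add: algebra_simps)
    then show ?case using step assms(3)[OF \<open>a \<in> A\<close>] by (simp add: idl.span_add idl.span_scale)
  qed
  moreover have "(c * a + x) * y = c * (a * y) + x * y" by (simp add: algebra_simps)
  ultimately show ?case using step by (simp add: idl.span_add idl.span_scale)
qed

lemma pow_gens_SucI: "g \<in> G \<Longrightarrow> h \<in> pow_gens G r \<Longrightarrow> g * h \<in> pow_gens G (Suc r)"
  by auto

lemma pow_gens_SucE:
  assumes "f \<in> pow_gens G (Suc r)"
  obtains g h where "g \<in> G" "h \<in> pow_gens G r" "f = g * h"
  using assms by auto

lemma pow_gens_1: "pow_gens G (Suc 0) = G"
  by auto

lemma pow_gens_mono: "S \<subseteq> G \<Longrightarrow> pow_gens S n \<subseteq> pow_gens G n"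
  by (induction n) auto

lemma pow_gens_singleton: "pow_gens {g} n = {g ^ n}"
  by (induction n) auto

lemma pow_gens_Suc: "pow_gens G (Suc n) = prods G (pow_gens G n)"
  by (simp add: prods_def)

declare pow_gens.simps(2) [simp del]

lemma pow_gens_mult: "g \<in> pow_gens G m \<Longrightarrow> h \<in> pow_gens G n \<Longrightarrow> g * h \<in> pow_gens G (m + n)"
proof (induction m arbitrary: g)
  case 0
  then show ?case by simp
next
  case (Suc m)
  then obtain a b where ab: "a \<in> G" "b \<in> pow_gens G m" "g = a * b" by (elim pow_gens_SucE)
  have "a * (b * h) \<in> pow_gens G (Suc (m + n))"
    using Suc.IH[OF ab(2) Suc.prems(2)] ab(1) by (intro pow_gens_SucI)
  then show ?case using ab(3) by (simp add: mult.assoc)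
qed

lemma pow_gens_add: "pow_gens G (m + n) = prods (pow_gens G m) (pow_gens G n)"
proof (induction m)
  case 0
  then show ?case by (auto simp: prods_def)
next
  case (Suc m)
  have "pow_gens G (Suc m + n) = prods G (prods (pow_gens G m) (pow_gens G n))"
    using Suc by (simp add: pow_gens_Suc)
  also have "\<dots> = prods (pow_gens G (Suc m)) (pow_gens G n)"
    unfolding pow_gens_Suc by (auto simp: prods_def) (metis mult.assoc)+
  finally show ?case .
qed

lemma pow_gens_Un:
  "g \<in> pow_gens (S \<union> T) n \<Longrightarrow>
   \<exists>i j s t. i + j = n \<and> s \<in> pow_gens S i \<and> t \<in> pow_gens T j \<and> g = s * t"
proof (induction n arbitrary: g)
  case 0
  then show ?case by auto
next
  case (Suc n)
  then obtain a b where ab: "a \<in> S \<union> T" "b \<in> pow_gens (S \<union> T) n" "g = a * b" by (elim pow_gens_SucE)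
  from Suc.IH[OF ab(2)] obtain i j s t
    where st: "i + j = n" "s \<in> pow_gens S i" "t \<in> pow_gens T j" "b = s * t" by blast
  show ?case
  proof (cases "a \<in> S")
    case True
    then have "a * s \<in> pow_gens S (Suc i)" using st(2) by (rule pow_gens_SucI)
    moreover have "g = (a * s) * t" using ab st by (simp add: mult.assoc)
    ultimately show ?thesis using st(1,3) by (metis add_Suc)
  next
    case False
    then have "a * t \<in> pow_gens T (Suc j)" using st(3) ab(1) by (intro pow_gens_SucI) auto
    moreover have "g = s * (a * t)" using ab st by (simp add: algebra_simps)
    ultimately show ?thesis using st(1,2) by (metis add_Suc_right)
  qed
qed

lemma finite_pow_gens: "finite G \<Longrightarrow> finite (pow_gens G n)"
proof (induction n)
  case (Suc n)
  have "pow_gens G (Suc n) = (\<lambda>(g, h). g * h) ` (G \<times> pow_gens G n)"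
    by (auto simp: pow_gens_Suc prods_def)
  then show ?case using Suc by simp
qed simp

lemma power_in_span_pow_gens: "f \<in> idl.span G \<Longrightarrow> f ^ n \<in> idl.span (pow_gens G n)"
proof (induction n)
  case 0
  then show ?case by (simp add: idl.span_base)
next
  case (Suc n)
  then have "f * f ^ n \<in> idl.span (pow_gens G (Suc n))"
    by (intro span_times[of f G "f ^ n" "pow_gens G n"]) (auto intro!: idl.span_base pow_gens_SucI)
  then show ?case by simp
qed

text \<open>Nilpotency is meant in the graded ring \<open>\<Oplus> I^a / J I^(a-1)\<close>, with \<open>I\<close> generated by \<open>G\<close>.\<close>
definition nilpotent_gens :: "'p::comm_ring_1 set \<Rightarrow> 'p set \<Rightarrow> 'p set \<Rightarrow> bool" where
  "nilpotent_gens J G S \<longleftrightarrow> (\<exists>a. pow_gens S (Suc a) \<subseteq> idl.span (prods J (pow_gens G a)))"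

text \<open>J I^a is what becomes zero in degree a + 1 of the graded ring: a product vanishes there
  as soon as one factor does.\<close>

lemma span_prods_pow_gens_mult:
  assumes "f \<in> idl.span (prods J (pow_gens G a))" "h \<in> idl.span (pow_gens G b)"
  shows "f * h \<in> idl.span (prods J (pow_gens G (a + b)))"
proof (rule span_times[OF assms])
  fix x y assume "x \<in> prods J (pow_gens G a)" "y \<in> pow_gens G b"
  then obtain j g where "j \<in> J" "g \<in> pow_gens G a" "x = j * g" by (auto simp: prods_def)
  then have "x * y = j * (g * y)" by (simp add: mult.assoc)
  moreover have "g * y \<in> pow_gens G (a + b)"
    by (rule pow_gens_mult[OF \<open>g \<in> _\<close> \<open>y \<in> _\<close>])
  ultimately show "x * y \<in> idl.span (prods J (pow_gens G (a + b)))"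
    using \<open>j \<in> J\<close> by (metis idl.span_base prodsI)
qed

text \<open>Pigeonhole: among a + b + 1 factors from \<open>S \<union> T\<close>, at least a + 1
  come from \<open>S\<close> or at least b + 1 from \<open>T\<close>.\<close>

lemma nilpotent_gens_Un:
  assumes "nilpotent_gens J G S" "nilpotent_gens J G T" "S \<subseteq> G" "T \<subseteq> G"
  shows "nilpotent_gens J G (S \<union> T)"
proof -
  obtain a where a: "pow_gens S (Suc a) \<subseteq> idl.span (prods J (pow_gens G a))"
    using assms by (auto simp: nilpotent_gens_def)
  obtain b where b: "pow_gens T (Suc b) \<subseteq> idl.span (prods J (pow_gens G b))"
    using assms by (auto simp: nilpotent_gens_def)
  \<comment> \<open>Stated for arbitrary \<open>S\<close>, \<open>a\<close> and \<open>b\<close>,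
    since it is used a second time with the two sets exchanged.\<close>
  have key: "s * h \<in> idl.span (prods J (pow_gens G (a + b)))"
    if "pow_gens S (Suc a) \<subseteq> idl.span (prods J (pow_gens G a))" "S \<subseteq> G"
       "s \<in> pow_gens S i" "h \<in> pow_gens G j" "i + j = Suc (a + b)" and ia: "Suc a \<le> i" for a b i j s h S
  proof -
    obtain e where e: "i = Suc a + e" using le_Suc_ex[OF ia] by blast
    have "s \<in> prods (pow_gens S (Suc a)) (pow_gens S e)"
      using that(3) unfolding e pow_gens_add .
    then obtain s1 s2 where s: "s1 \<in> pow_gens S (Suc a)" "s2 \<in> pow_gens S e" "s = s1 * s2"
      by (auto simp: prods_def)
    have "s2 * h \<in> pow_gens G (e + j)"
      using pow_gens_mult[OF subsetD[OF pow_gens_mono[OF that(2)] s(2)] that(4)] .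
    then have "s1 * (s2 * h) \<in> idl.span (prods J (pow_gens G (a + (e + j))))"
      using that(1) s(1) by (intro span_prods_pow_gens_mult) (auto intro: idl.span_base)
    moreover have "a + (e + j) = a + b" using that e by simp
    ultimately show ?thesis using s by (simp add: mult.assoc)
  qed
  have "g \<in> idl.span (prods J (pow_gens G (a + b)))" if g: "g \<in> pow_gens (S \<union> T) (Suc (a + b))" for g
  proof -
    obtain i j s t where st: "i + j = Suc (a + b)" "s \<in> pow_gens S i" "t \<in> pow_gens T j" "g = s * t"
      using pow_gens_Un[OF g] by blast
    show ?thesis
    proof (cases "Suc a \<le> i")
      case True
      have "t \<in> pow_gens G j" using st(3) pow_gens_mono[OF assms(4)] by blast
      then show ?thesis using key[OF a assms(3) st(2) _ st(1) True] st(4) by simp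
    next
      case False
      then have "Suc b \<le> j" "j + i = Suc (b + a)" using st by auto
      moreover have "s \<in> pow_gens G i" using st(2) pow_gens_mono[OF assms(3)] by blast
      ultimately have "t * s \<in> idl.span (prods J (pow_gens G (b + a)))"
        using key[OF b assms(4) st(3)] by blast
      then show ?thesis using st(4) by (simp add: ac_simps)
    qed
  qed
  then show ?thesis unfolding nilpotent_gens_def by blast
qed

lemma nilpotent_gens_Union:
  assumes "finite F" "\<And>S. S \<in> F \<Longrightarrow> nilpotent_gens J G S \<and> S \<subseteq> G" "F \<noteq> {}"
  shows "nilpotent_gens J G (\<Union>F)"
  using assms(1,3,2)
proof (induction rule: finite_ne_induct)
  case (insert S F)
  then have "nilpotent_gens J G (S \<union> \<Union>F)" by (intro nilpotent_gens_Un) blast+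
  then show ?case by simp
qed simp

text \<open>In the graded ring, g^2 lies in the ideal generated by \<open>S\<close>. So g^(2N) is a
  combination of N-fold products from \<open>S\<close>, which are zero for N = a + 1.\<close>

lemma nilpotent_gens_singleton:
  assumes "nilpotent_gens J G S" "S \<subseteq> G" "J \<subseteq> idl.span G"
    and sq: "g ^ 2 \<in> idl.span (prods J G \<union> prods S G)"
  shows "nilpotent_gens J G {g}"
proof -
  obtain a where a: "pow_gens S (Suc a) \<subseteq> idl.span (prods J (pow_gens G a))"
    using assms by (auto simp: nilpotent_gens_def)
  have in_I2: "x \<in> idl.span (pow_gens G 2)" if "x \<in> prods J G \<union> prods S G" for x
  proof -
    obtain j h where "j \<in> idl.span G" "h \<in> G" "x = j * h"
      using \<open>x \<in> _\<close> assms(2,3) by (auto simp: prods_def intro: idl.span_base)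
    moreover from this have "j * h \<in> idl.span (prods G G)"
      by (intro span_times[of j G h G]) (auto intro: idl.span_base prodsI)
    ultimately show ?thesis by (simp add: numeral_2_eq_2 pow_gens_Suc[of _ "Suc 0"] pow_gens_1)
  qed
  \<comment> \<open>The first set stands for the generators of J I^(2N-1): the condition on
    \<open>M\<close> is solved by 2N - 1 only, and by nothing if N = 0.\<close>
  have step: "(g ^ 2) ^ N \<in> idl.span ((\<Union>M\<in>{M. Suc M = 2 * N}. prods J (pow_gens G M)) \<union> prods (pow_gens S N) (pow_gens G N))" for N
  proof (induction N)
    case 0
    then show ?case by (auto intro!: idl.span_base simp: prods_def)
  next
    case (Suc N)
    have "(g ^ 2) ^ N * g ^ 2 \<in> idl.span ((\<Union>M\<in>{M. Suc M = 2 * Suc N}. prods J (pow_gens G M)) \<union> prods (pow_gens S (Suc N)) (pow_gens G (Suc N)))"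
      (is "_ \<in> idl.span ?T")
    proof (rule span_times[OF Suc sq])
      fix x y
      assume x: "x \<in> (\<Union>M\<in>{M. Suc M = 2 * N}. prods J (pow_gens G M)) \<union> prods (pow_gens S N) (pow_gens G N)"
        and y: "y \<in> prods J G \<union> prods S G"
      have JT: "idl.span (prods J (pow_gens G (Suc (2 * N)))) \<subseteq> idl.span ?T"
        by (intro idl.span_mono) auto
      consider (A) M where "Suc M = 2 * N" "x \<in> prods J (pow_gens G M)" "y \<in> prods J G \<union> prods S G"
        | (B) "x \<in> prods (pow_gens S N) (pow_gens G N)" "y \<in> prods S G"
        | (C) "x \<in> prods (pow_gens S N) (pow_gens G N)" "y \<in> prods J G"
        using x y by blast
      then show "x * y \<in> idl.span ?T"
      proof cases
        case B
        then obtain s h s' h' where *: "s \<in> pow_gens S N" "h \<in> pow_gens G N" "x = s * h"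
          "s' \<in> S" "h' \<in> G" "y = s' * h'" by (auto simp: prods_def)
        then have "s' * s \<in> pow_gens S (Suc N)" "h' * h \<in> pow_gens G (Suc N)"
          by (auto intro: pow_gens_SucI)
        moreover have "x * y = (s' * s) * (h' * h)" using * by (simp add: algebra_simps)
        ultimately have "x * y \<in> ?T" using prodsI by (metis UnI2)
        then show ?thesis by (rule idl.span_base)
      next
        case C
        then obtain s h where *: "s \<in> pow_gens S N" "h \<in> pow_gens G N" "x = s * h"
          by (auto simp: prods_def)
        then have "x \<in> pow_gens G (N + N)"
          using pow_gens_mono[OF assms(2)] pow_gens_mult by blast
        moreover have "y \<in> idl.span (prods J (pow_gens G 1))"
          using C by (simp add: pow_gens_1 idl.span_base)
        ultimately have "y * x \<in> idl.span (prods J (pow_gens G (1 + (N + N))))"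
          by (intro span_prods_pow_gens_mult) (auto intro: idl.span_base)
        then show ?thesis using JT by (auto simp: mult.commute[of x y] mult_2)
      next
        case A
        then have "x * y \<in> idl.span (prods J (pow_gens G (M + 2)))"
          using in_I2 by (intro span_prods_pow_gens_mult) (auto intro: idl.span_base)
        moreover have "M + 2 = Suc (2 * N)" using A by simp
        ultimately show ?thesis using JT by auto
      qed
    qed
    then show ?case by (simp add: mult.commute)
  qed
  have "(g ^ 2) ^ Suc a \<in> idl.span (prods J (pow_gens G (Suc (2 * a))))"
  proof -
    have "x \<in> idl.span (prods J (pow_gens G (Suc (2 * a))))"
      if "x \<in> prods (pow_gens S (Suc a)) (pow_gens G (Suc a))" for x
    proof -
      obtain s h where "s \<in> pow_gens S (Suc a)" "h \<in> pow_gens G (Suc a)" "x = s * h"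
        using \<open>x \<in> _\<close> unfolding prods_def by blast
      moreover from this have "s * h \<in> idl.span (prods J (pow_gens G (a + Suc a)))"
        using a by (intro span_prods_pow_gens_mult) (auto intro: idl.span_base)
      ultimately show ?thesis by (simp add: mult_2)
    qed
    then have "(\<Union>M\<in>{M. Suc M = 2 * Suc a}. prods J (pow_gens G M))
        \<union> prods (pow_gens S (Suc a)) (pow_gens G (Suc a))
        \<subseteq> idl.span (prods J (pow_gens G (Suc (2 * a))))"
      by (auto intro: idl.span_base)
    then show ?thesis using step[of "Suc a"] idl.span_minimal idl.subspace_span by blast
  qed
  moreover have "(g ^ 2) ^ Suc a = g ^ Suc (Suc (2 * a))"
    by (metis mult_2 mult_Suc_right power_mult add_2_eq_Suc)
  ultimately show ?thesis
    unfolding nilpotent_gens_def pow_gens_singleton by (metis empty_subsetI insert_subset)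
qed

subsection \<open>Diagonals of a Young diagram\<close>

definition young_diagram :: "(nat \<times> nat) set \<Rightarrow> bool" where
  "young_diagram L \<longleftrightarrow> finite L \<and> (\<forall>i j. (i, j) \<in> L \<longrightarrow> 1 \<le> i \<and> 1 \<le> j) \<and>
     (\<forall>i j i' j'. (i, j) \<in> L \<longrightarrow> 1 \<le> i' \<longrightarrow> i' \<le> i \<longrightarrow> 1 \<le> j' \<longrightarrow> j' \<le> j \<longrightarrow> (i', j') \<in> L)"

definition cell_diag :: "nat \<times> nat \<Rightarrow> int" where
  "cell_diag c = int (snd c) - int (fst c)"

definition gens :: "(nat \<times> nat) set \<Rightarrow> (nat \<Rightarrow> 'p::comm_ring_1) \<Rightarrow> (nat \<Rightarrow> 'p) \<Rightarrow> 'p set" where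
  "gens L X Y = (\<lambda>(i, j). X i * Y j) ` L"

text \<open>One integer index covers both families of diagonals: k for the first, -k for the second.
  \<open>L\<close> may be any set of cells, because the sums are also needed for the transposed
  diagram and for a piece of the diagram.\<close>

definition diag_sum :: "(nat \<times> nat) set \<Rightarrow> (nat \<Rightarrow> 'p::comm_ring_1) \<Rightarrow> (nat \<Rightarrow> 'p) \<Rightarrow> int \<Rightarrow> 'p" where
  "diag_sum L X Y k = (\<Sum>(i, j)\<in>{c \<in> L. cell_diag c = k}. X i * Y j)"

lemma diag_sum_in_span_gens: "diag_sum L X Y k \<in> idl.span (gens L X Y)"
  unfolding diag_sum_def by (intro idl.span_sum) (auto simp: gens_def intro!: idl.span_base)

lemma young_diagram_pos: "young_diagram L \<Longrightarrow> (i, j) \<in> L \<Longrightarrow> 1 \<le> i \<and> 1 \<le> j"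
  unfolding young_diagram_def by blast

lemma young_diagram_down:
  "young_diagram L \<Longrightarrow> (i, j) \<in> L \<Longrightarrow> 1 \<le> i' \<Longrightarrow> i' \<le> i \<Longrightarrow> 1 \<le> j' \<Longrightarrow> j' \<le> j \<Longrightarrow> (i', j') \<in> L"
  unfolding young_diagram_def by blast

lemma diagonals_reduction:
  assumes L: "young_diagram L"
  shows "\<exists>r. pow_gens (gens L X Y) (Suc r)
              \<subseteq> idl.span (prods (range (diag_sum L X Y)) (pow_gens (gens L X Y) r))"
proof -
  define G where "G = gens L X Y"
  define J where "J = range (diag_sum L X Y)"
  define S where "S k = gens {c \<in> L. k \<le> cell_diag c} X Y" for k
  have fin: "finite L" using L by (simp add: young_diagram_def)
  have JG: "J \<subseteq> idl.span G" using diag_sum_in_span_gens by (auto simp: J_def G_def)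
  have SG: "S k \<subseteq> G" for k by (auto simp: S_def G_def gens_def)
  \<comment> \<open>One above the highest diagonal, so that \<open>S b\<close> is empty and the
    induction can start.\<close>
  define b where "b = (if L = {} then 0 else Max (cell_diag ` L)) + 1"
  define a where "a = (if L = {} then 0 else Min (cell_diag ` L))"
  have b: "cell_diag c < b" if "c \<in> L" for c
    using that fin Max_ge[of "cell_diag ` L" "cell_diag c"] by (auto simp: b_def)
  have a: "a \<le> cell_diag c" if "c \<in> L" for c
    using that fin Min_le[of "cell_diag ` L" "cell_diag c"] by (auto simp: a_def)
  have "nilpotent_gens J G (S (b - int e))" for e
  proof (induction e)
    case 0
    have "S b = {}" using b by (force simp: S_def gens_def)
    then have "pow_gens (S b) (Suc 0) = {}" by (simp add: pow_gens_1)
    then show ?case unfolding nilpotent_gens_def of_nat_0 diff_0_right by (metis empty_subsetI)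
  next
    case (Suc e)
    define k where "k = b - int e - 1"
    have IH: "nilpotent_gens J G (S (k + 1))" using Suc by (simp add: k_def)
    define D where "D = {c \<in> L. cell_diag c = k}"
    have single: "nilpotent_gens J G {X i * Y j}" if ij: "(i, j) \<in> D" for i j
    proof (rule nilpotent_gens_singleton[OF IH SG JG])
      have g: "X i * Y j \<in> G" using ij by (auto simp: D_def G_def gens_def)
      have finD: "finite D" using fin by (simp add: D_def)
      have "diag_sum L X Y k = X i * Y j + (\<Sum>(i', j')\<in>D - {(i, j)}. X i' * Y j')"
        using sum.remove[OF finD ij, of "\<lambda>(i, j). X i * Y j"] by (simp add: diag_sum_def D_def)
      then have eq: "(X i * Y j)\<^sup>2 = diag_sum L X Y k * (X i * Y j)
          - (\<Sum>c\<in>D - {(i, j)}. (X i * Y j) * (case c of (i', j') \<Rightarrow> X i' * Y j'))"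
        by (simp add: power2_eq_square algebra_simps flip: sum_distrib_left)
      have prod: "(X i * Y j) * (X i' * Y j') \<in> prods (S (k + 1)) G"
        if c: "(i', j') \<in> D" "(i', j') \<noteq> (i, j)" for i' j'
      proof -
        \<comment> \<open>Exchanging the columns of the two cells keeps the product. The new cell
          (i, j') lies on a higher diagonal, and it belongs to \<open>L\<close> because (i', j')
          does.\<close>
        have swap: "(X i * Y j) * (X i' * Y j') \<in> prods (S (k + 1)) G"
          if c: "(i, j) \<in> D" "(i', j') \<in> D" "i < i'" for i j i' j'
        proof -
          have "j < j'" using c by (auto simp: D_def cell_diag_def)
          have "1 \<le> i" "1 \<le> j" using c L by (auto simp: D_def young_diagram_def)
          then have "(i, j') \<in> L" "(i', j) \<in> L"
            using c \<open>j < j'\<close> young_diagram_down[OF L, of i' j'] by (auto simp: D_def)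
          moreover have "k + 1 \<le> cell_diag (i, j')" using c by (auto simp: D_def cell_diag_def)
          ultimately have "X i * Y j' \<in> S (k + 1)" "X i' * Y j \<in> G"
            by (auto simp: S_def G_def gens_def)
          then have "(X i * Y j') * (X i' * Y j) \<in> prods (S (k + 1)) G" by (rule prodsI)
          then show ?thesis by (simp add: algebra_simps)
        qed
        have "i \<noteq> i'" using c ij by (auto simp: D_def cell_diag_def)
        then show ?thesis
          using swap[OF ij c(1)] swap[OF c(1) ij] by (metis linorder_neqE_nat mult.commute)
      qed
      show "(X i * Y j)\<^sup>2 \<in> idl.span (prods J G \<union> prods (S (k + 1)) G)"
        unfolding eq
      proof (intro idl.span_diff idl.span_sum)
        show "diag_sum L X Y k * (X i * Y j) \<in> idl.span (prods J G \<union> prods (S (k + 1)) G)"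
          using g by (intro idl.span_base UnI1 prodsI) (auto simp: J_def)
      next
        fix c assume "c \<in> D - {(i, j)}"
        then show "(X i * Y j) * (case c of (i', j') \<Rightarrow> X i' * Y j')
            \<in> idl.span (prods J G \<union> prods (S (k + 1)) G)"
          using prod by (intro idl.span_base UnI2) (auto split: prod.split)
      qed
    qed
    define F where "F = insert (S (k + 1)) ((\<lambda>(i, j). {X i * Y j}) ` D)"
    have "finite F" using fin by (simp add: F_def D_def)
    moreover have "nilpotent_gens J G T \<and> T \<subseteq> G" if T: "T \<in> F" for T
    proof (cases "T = S (k + 1)")
      case True
      then show ?thesis using IH SG by simp
    next
      case False
      then obtain i j where "(i, j) \<in> D" "T = {X i * Y j}" using T unfolding F_def by blast
      then show ?thesis using single by (auto simp: D_def G_def gens_def)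
    qed
    ultimately have "nilpotent_gens J G (\<Union>F)" by (intro nilpotent_gens_Union) (auto simp: F_def)
    moreover have "\<Union>F = S k"
    proof -
      have "{c \<in> L. k \<le> cell_diag c} = {c \<in> L. k + 1 \<le> cell_diag c} \<union> D" by (auto simp: D_def)
      then have "S k = S (k + 1) \<union> gens D X Y" unfolding S_def gens_def by (simp only: image_Un)
      then show ?thesis by (auto simp: F_def gens_def)
    qed
    ultimately show ?case by (simp add: k_def algebra_simps)
  qed
  \<comment> \<open>Truncation by \<open>nat\<close> turns \<open>b - int (nat (b - a))\<close> into
    \<open>min a b\<close>; no cell lies on a lower diagonal.\<close>
  from this[of "nat (b - a)"] have "nilpotent_gens J G (S (min a b))" by (simp add: min_def split: if_splits)
  moreover have "S (min a b) = G"
    using a by (force simp: S_def G_def gens_def)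
  ultimately show ?thesis by (simp add: nilpotent_gens_def G_def J_def)
qed

subsection \<open>Nakayama's lemma and power series\<close>

text \<open>Neither localisations nor residue rings are formed: elements outside a prime stand for
  units of the local ring, and equality in the residue ring becomes membership of a
  difference.\<close>

definition prime_idl :: "'p::comm_ring_1 set \<Rightarrow> bool" where
  "prime_idl Q \<longleftrightarrow> idl.subspace Q \<and> 1 \<notin> Q \<and> (\<forall>a b. a * b \<in> Q \<longrightarrow> a \<in> Q \<or> b \<in> Q)"

lemma prime_idl_subspace: "prime_idl Q \<Longrightarrow> idl.subspace Q"
  by (simp add: prime_idl_def)

lemma prime_idl_mult: "prime_idl Q \<Longrightarrow> a \<notin> Q \<Longrightarrow> b \<notin> Q \<Longrightarrow> a * b \<notin> Q"
  unfolding prime_idl_def by blast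

lemma prime_idl_power: "prime_idl Q \<Longrightarrow> a \<notin> Q \<Longrightarrow> a ^ n \<notin> Q"
  by (induction n) (auto simp: prime_idl_mult prime_idl_def[of Q])

text \<open>Nakayama's lemma: the ring \<open>'b\<close> acts on \<open>'a\<close> through \<open>act\<close>, the \<open>v g\<close> generate a module modulo
  the submodule \<open>N\<close>, and one generator is eliminated at a time.\<close>
lemma nakayama_elimination:
  fixes act :: "'b::comm_ring_1 \<Rightarrow> 'a::comm_ring_1"
  assumes add: "\<And>a b. act (a + b) = act a + act b"
    and mult: "\<And>a b. act (a * b) = act a * act b"
    and S: "prime_idl S"
    and Nadd: "\<And>x y. x \<in> N \<Longrightarrow> y \<in> N \<Longrightarrow> x + y \<in> N"
    and N0: "0 \<in> N"
    and Nact: "\<And>b x. x \<in> N \<Longrightarrow> act b * x \<in> N"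
    and "finite G"
    and "\<forall>g\<in>G. \<exists>a h. a \<notin> S \<and> (\<forall>l\<in>G. h l \<in> S) \<and> act a * v g - (\<Sum>l\<in>G. act (h l) * v l) \<in> N"
  shows "\<exists>a. a \<notin> S \<and> (\<forall>g\<in>G. act a * v g \<in> N)"
  using assms(7,8)
proof (induction G rule: finite_induct)
  case empty
  then show ?case using S by (auto simp: prime_idl_def)
next
  case (insert g0 G)
  have act_diff: "act (a - b) = act a - act b" for a b
    using add[of "a - b" b] by (simp add: algebra_simps)
  obtain a0 h0 where a0: "a0 \<notin> S" "\<forall>l\<in>insert g0 G. h0 l \<in> S"
    "act a0 * v g0 - (\<Sum>l\<in>insert g0 G. act (h0 l) * v l) \<in> N"
    using insert.prems by blast
  \<comment> \<open>Moves the term of \<open>g0\<close> in its own relation to the left. Since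
    \<open>h0 g0\<close> lies in \<open>S\<close> and \<open>a0\<close> does not, \<open>c\<close>
    stays outside \<open>S\<close>.\<close>
  define c where "c = a0 - h0 g0"
  have sub: "idl.subspace S" using S by (rule prime_idl_subspace)
  have c: "c \<notin> S"
    using a0 idl.subspace_add[OF sub, of c "h0 g0"] by (auto simp: c_def)
  have g0: "act c * v g0 - (\<Sum>l\<in>G. act (h0 l) * v l) \<in> N"
    using a0(3) insert.hyps by (simp add: c_def act_diff algebra_simps)
  have "\<exists>a h. a \<notin> S \<and> (\<forall>l\<in>G. h l \<in> S) \<and> act a * v g - (\<Sum>l\<in>G. act (h l) * v l) \<in> N" if "g \<in> G" for g
  proof -
    obtain a h where ah: "a \<notin> S" "\<forall>l\<in>insert g0 G. h l \<in> S"
      "act a * v g - (\<Sum>l\<in>insert g0 G. act (h l) * v l) \<in> N"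
      using insert.prems \<open>g \<in> G\<close> by blast
    \<comment> \<open>\<open>c\<close> times the relation of \<open>g\<close> plus
      \<open>h g0\<close> times that of \<open>g0\<close>: the terms with \<open>v g0\<close>
      cancel.\<close>
    have eq: "act c * (act a * v g - (\<Sum>l\<in>insert g0 G. act (h l) * v l))
          + act (h g0) * (act c * v g0 - (\<Sum>l\<in>G. act (h0 l) * v l))
          = act (c * a) * v g - (\<Sum>l\<in>G. act (c * h l + h g0 * h0 l) * v l)"
      using insert.hyps by (simp add: mult add algebra_simps sum.distrib sum_distrib_left)
    have "act (c * a) * v g - (\<Sum>l\<in>G. act (c * h l + h g0 * h0 l) * v l) \<in> N"
      using Nadd[OF Nact[OF ah(3), of c] Nact[OF g0, of "h g0"]] unfolding eq .
    moreover have "\<forall>l\<in>G. c * h l + h g0 * h0 l \<in> S"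
      using ah a0 idl.subspace_add[OF sub] idl.subspace_scale[OF sub] by auto
    moreover have "c * a \<notin> S" using S c ah by (simp add: prime_idl_mult)
    ultimately show ?thesis by (intro exI[of _ "c * a"] exI[of _ "\<lambda>l. c * h l + h g0 * h0 l"]) auto
  qed
  then obtain a where a: "a \<notin> S" "\<forall>g\<in>G. act a * v g \<in> N" using insert.IH by blast
  have sumN: "sum f B \<in> N" if "\<And>l. l \<in> B \<Longrightarrow> f l \<in> N" for f and B :: "'c set"
    using that by (induction B rule: infinite_finite_induct) (auto simp: N0 Nadd)
  \<comment> \<open>Back substitution: on the right of the relation of \<open>g0\<close> there
    remain only generators that \<open>a\<close> sends into \<open>N\<close>.\<close>
  have "act a * (act c * v g0 - (\<Sum>l\<in>G. act (h0 l) * v l)) + (\<Sum>l\<in>G. act (h0 l) * (act a * v l)) \<in> N"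
    using a Nact g0 by (intro Nadd sumN) auto
  then have "act (a * c) * v g0 \<in> N"
    by (simp add: mult algebra_simps sum_distrib_left)
  moreover have "act (a * c) * v g \<in> N" if "g \<in> G" for g
    using a that Nact[of "act a * v g" c] by (simp add: mult algebra_simps)
  ultimately show ?case using prime_idl_mult[OF S a(1) c] by (intro exI[of _ "a * c"]) auto
qed

text \<open>The kernel of R[[t]] \<rightarrow> (R/Q)[[t]].\<close>

definition fps_idl :: "'p::comm_ring_1 set \<Rightarrow> 'p fps set" where
  "fps_idl Q = {f. \<forall>n. fps_nth f n \<in> Q}"

text \<open>In degree a + b, where a and b are the lowest degrees with coefficients outside
  \<open>Q\<close>, the product of these two coefficients is the only summand outside
  \<open>Q\<close>.\<close>

lemma prime_fps_idl:
  assumes "prime_idl Q"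
  shows "prime_idl (fps_idl Q)"
  unfolding prime_idl_def
proof (intro conjI allI impI)
  have sub: "idl.subspace Q" using assms by (rule prime_idl_subspace)
  show "idl.subspace (fps_idl Q)"
    unfolding idl.subspace_def
    by (auto simp: fps_idl_def fps_mult_nth
        intro!: idl.subspace_sum[OF sub] idl.subspace_scale[OF sub]
        idl.subspace_add[OF sub] idl.subspace_0[OF sub])
  show "1 \<notin> fps_idl Q" using assms by (auto simp: fps_idl_def prime_idl_def intro!: exI[of _ 0])
  fix f g :: "'a fps" assume fg: "f * g \<in> fps_idl Q"
  show "f \<in> fps_idl Q \<or> g \<in> fps_idl Q"
  proof (rule ccontr)
    assume "\<not> ?thesis"
    then have ex: "\<exists>n. fps_nth f n \<notin> Q" "\<exists>n. fps_nth g n \<notin> Q" by (auto simp: fps_idl_def)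
    define a where "a = (LEAST n. fps_nth f n \<notin> Q)"
    define b where "b = (LEAST n. fps_nth g n \<notin> Q)"
    have a: "fps_nth f a \<notin> Q" "\<And>i. i < a \<Longrightarrow> fps_nth f i \<in> Q"
      unfolding a_def using LeastI_ex[OF ex(1)] not_less_Least by blast+
    have b: "fps_nth g b \<notin> Q" "\<And>i. i < b \<Longrightarrow> fps_nth g i \<in> Q"
      unfolding b_def using LeastI_ex[OF ex(2)] not_less_Least by blast+
    have "fps_nth (f * g) (a + b) = (\<Sum>i=0..a + b. fps_nth f i * fps_nth g (a + b - i))"
      by (simp add: fps_mult_nth)
    also have "\<dots> = fps_nth f a * fps_nth g b
        + (\<Sum>i\<in>{0..a + b} - {a}. fps_nth f i * fps_nth g (a + b - i))"
      by (subst sum.remove[of _ a]) auto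
    finally have "fps_nth f a * fps_nth g b = fps_nth (f * g) (a + b)
        - (\<Sum>i\<in>{0..a + b} - {a}. fps_nth f i * fps_nth g (a + b - i))" by simp
    also have "\<dots> \<in> Q"
    proof (intro idl.subspace_diff[OF sub] idl.subspace_sum[OF sub])
      show "fps_nth (f * g) (a + b) \<in> Q" using fg by (simp add: fps_idl_def)
      fix i assume "i \<in> {0..a + b} - {a}"
      then consider "i < a" | "a + b - i < b" by fastforce
      then show "fps_nth f i * fps_nth g (a + b - i) \<in> Q"
        using a(2) b(2) idl.subspace_scale[OF sub] by cases (metis mult.commute)+
    qed
    finally show False using prime_idl_mult[OF assms a(1) b(1)] by blast
  qed
qed

text \<open>A formal implicit function theorem. The right hand side is a contraction for the X-adic
  distance: each iteration settles one more coefficient.\<close>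

lemma fps_fixpoint:
  fixes G :: "('k \<Rightarrow> 'p::comm_ring_1 fps) \<Rightarrow> 'k \<Rightarrow> 'p fps"
  assumes G: "\<And>N v w k. (\<And>l i. i < N \<Longrightarrow> fps_nth (v l) i = fps_nth (w l) i) \<Longrightarrow>
                \<forall>i<N. fps_nth (G v k) i = fps_nth (G w k) i"
  shows "\<exists>v. \<forall>k. v k = U k + fps_X * G v k"
proof -
  define F where "F v k = U k + fps_X * G v k" for v k
  define it where "it n = (F ^^ n) (\<lambda>_. 0)" for n
  have it_Suc: "it (Suc n) = F (it n)" for n by (simp add: it_def)
  have F: "\<forall>i<Suc N. fps_nth (F v k) i = fps_nth (F w k) i"
    if "\<And>l i. i < N \<Longrightarrow> fps_nth (v l) i = fps_nth (w l) i" for N v w k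
    using G[OF that] by (auto simp: F_def)
  have step: "\<forall>l. \<forall>i<n. fps_nth (it n l) i = fps_nth (it (n + m) l) i" for n m
  proof (induction n)
    case (Suc n)
    then show ?case using F[of n "it n" "it (n + m)"] by (simp add: it_Suc)
  qed simp
  \<comment> \<open>Coefficient i no longer changes from iterate i + 1 on.\<close>
  define v where "v k = Abs_fps (\<lambda>i. fps_nth (it (Suc i) k) i)" for k
  have v: "fps_nth (v k) i = fps_nth (it n k) i" if i: "i < n" for k i n
  proof -
    obtain m where "n = Suc i + m" using le_Suc_ex[OF Suc_leI[OF i]] by blast
    then show ?thesis using step[of "Suc i" m] by (simp add: v_def)
  qed
  have "v k = F v k" for k
  proof (rule fps_ext)
    fix i
    have "fps_nth (v k) i = fps_nth (F (it i) k) i" by (simp add: v[of i "Suc i"] it_Suc)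
    also have "\<dots> = fps_nth (F v k) i" using F[of i "it i" v k] v by simp
    finally show "fps_nth (v k) i = fps_nth (F v k) i" .
  qed
  then show ?thesis unfolding F_def by blast
qed

lemma fps_mult_nth_cong:
  assumes "\<And>i. i < N \<Longrightarrow> fps_nth f i = fps_nth f' i" "\<And>i. i < N \<Longrightarrow> fps_nth g i = fps_nth g' i"
  shows "\<forall>i<N. fps_nth (f * g) i = fps_nth (f' * g') i"
  using assms by (auto simp: fps_mult_nth intro!: sum.cong)

text \<open>At \<open>X a = Y b = 1\<close> and all other variables \<open>0\<close>, the diagonal sums have an invertible Jacobian,
  so that they can be solved for over the power series ring.\<close>
lemma diag_sum_solvable:
  fixes U :: "int \<Rightarrow> 'p::comm_ring_1 fps"
  assumes fin: "finite M"
    and corner: "\<And>s t. (s, t) \<in> M \<Longrightarrow> a \<le> s \<and> b \<le> t"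
    and down: "\<And>s t s' t'. (s, t) \<in> M \<Longrightarrow> a \<le> s' \<Longrightarrow> s' \<le> s \<Longrightarrow> b \<le> t' \<Longrightarrow> t' \<le> t \<Longrightarrow> (s', t') \<in> M"
  shows "\<exists>\<alpha> \<beta>. \<forall>c\<in>M. diag_sum M \<alpha> \<beta> (cell_diag c)
            = of_bool (cell_diag c = int b - int a) + fps_X * U (cell_diag c)"
proof -
  define k0 where "k0 = int b - int a"
  \<comment> \<open>The cells off row \<open>a\<close> and column \<open>b\<close>. Both of their
    factors will be divisible by \<open>fps_X\<close>, so that they enter only at second
    order.\<close>
  define R where "R k = {c \<in> M. cell_diag c = k \<and> fst c \<noteq> a \<and> snd c \<noteq> b}" for k
  define G where "G v k = - ((if k < k0 then v k * v k0 else 0)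
      + (\<Sum>(s, t)\<in>R k. v (int b - int s) * v (int t - int a)))" for v :: "int \<Rightarrow> 'p fps" and k
  have "\<exists>v. \<forall>k. v k = U k + fps_X * G v k"
  proof (rule fps_fixpoint)
    fix N k and v w :: "int \<Rightarrow> 'p fps"
    assume *: "\<And>l i. i < N \<Longrightarrow> fps_nth (v l) i = fps_nth (w l) i"
    have "\<forall>i<N. fps_nth (v l * v l') i = fps_nth (w l * w l') i" for l l'
      using fps_mult_nth_cong[OF * *] .
    then show "\<forall>i<N. fps_nth (G v k) i = fps_nth (G w k) i"
      by (auto simp: G_def fps_sum_nth intro!: sum.cong)
  qed
  then obtain v where v: "\<And>k. v k = U k + fps_X * G v k" by blast
  \<comment> \<open>One unknown per diagonal: \<open>v k\<close> perturbs the variable of the cell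
    in which diagonal \<open>k\<close> meets the hook formed by row \<open>a\<close> and column
    \<open>b\<close>. The corner diagonal perturbs \<open>\<beta> b\<close>, while
    \<open>\<alpha> a\<close> is fixed at 1.\<close>
  define \<alpha> where "\<alpha> s = (if s = a then 1 else fps_X * v (int b - int s))" for s
  define \<beta> where "\<beta> t = of_bool (t = b) + fps_X * v (int t - int a)" for t
  have "diag_sum M \<alpha> \<beta> k = of_bool (k = k0) + fps_X * U k" if c: "c \<in> M" "cell_diag c = k" for c k
  proof -
    obtain s t where st: "c = (s, t)" by (cases c)
    have ab: "a \<le> s" "b \<le> t" using corner c st by auto
    have k: "k = int t - int s" using c st by (simp add: cell_diag_def)
    \<comment> \<open>The hook cell of the diagonal. It carries the linear term \<open>v k\<close>,
      with coefficient 1.\<close>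
    define h where "h = (if k < k0 then (nat (int b - k), b) else (a, nat (int a + k)))"
    have hM: "h \<in> M"
    proof (cases "k < k0")
      case True
      then show ?thesis using down[of s t "nat (int b - k)" b] c st ab by (auto simp: h_def k k0_def)
    next
      case False
      then show ?thesis using down[of s t a "nat (int a + k)"] c st ab by (auto simp: h_def k k0_def)
    qed
    have hk: "cell_diag h = k" using ab by (auto simp: h_def cell_diag_def k k0_def)
    have "{c \<in> M. cell_diag c = k} = insert h (R k)"
    proof (intro equalityI subsetI)
      fix c' assume c': "c' \<in> {c \<in> M. cell_diag c = k}"
      obtain s' t' where st': "c' = (s', t')" by (cases c')
      have "a \<le> s'" "b \<le> t'" "k = int t' - int s'" using c' st' corner by (auto simp: cell_diag_def)
      then show "c' \<in> insert h (R k)" using c' st' by (auto simp: R_def h_def k0_def)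
    qed (use hM hk in \<open>auto simp: R_def\<close>)
    moreover have "h \<notin> R k" by (auto simp: h_def R_def)
    moreover have "finite (R k)" using fin by (simp add: R_def)
    ultimately have "diag_sum M \<alpha> \<beta> k = \<alpha> (fst h) * \<beta> (snd h) + (\<Sum>(s, t)\<in>R k. \<alpha> s * \<beta> t)"
      by (simp add: diag_sum_def split: prod.split)
    also have "(\<Sum>(s, t)\<in>R k. \<alpha> s * \<beta> t)
        = fps_X * (fps_X * (\<Sum>(s, t)\<in>R k. v (int b - int s) * v (int t - int a)))"
      unfolding sum_distrib_left
      by (intro sum.cong) (auto simp: R_def \<alpha>_def \<beta>_def algebra_simps)
    also have "\<alpha> (fst h) * \<beta> (snd h)
        = of_bool (k = k0) + fps_X * v k + fps_X * (fps_X * (if k < k0 then v k * v k0 else 0))"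
    proof (cases "k < k0")
      case True
      then have "int (nat (int b - k)) = int b - k" "nat (int b - k) \<noteq> a"
        using ab by (auto simp: k k0_def)
      then show ?thesis using True by (simp add: h_def \<alpha>_def \<beta>_def k0_def algebra_simps)
    next
      case False
      then have "int b \<le> int a + k" by (simp add: k0_def)
      then have *: "int (nat (int a + k)) = int a + k" "nat (int a + k) = b \<longleftrightarrow> k = k0"
        unfolding k0_def by linarith+
      show ?thesis using False by (simp add: h_def \<alpha>_def \<beta>_def * del: int_nat_eq)
    qed
    finally have "diag_sum M \<alpha> \<beta> k = of_bool (k = k0) + fps_X * (v k - fps_X * G v k)"
      by (simp add: G_def algebra_simps)
    then show ?thesis using v[of k] by (metis add_diff_cancel_right')
  qed
  then show ?thesis unfolding k0_def by blast
qed

subsection \<open>Evaluation of multivariate polynomials\<close>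

definition is_ring_hom :: "('p::comm_ring_1 \<Rightarrow> 'q::comm_ring_1) \<Rightarrow> bool" where
  "is_ring_hom f \<longleftrightarrow> f 0 = 0 \<and> f 1 = 1 \<and> (\<forall>a b. f (a + b) = f a + f b) \<and> (\<forall>a b. f (a * b) = f a * f b)"

lemma is_ring_homD:
  assumes "is_ring_hom f"
  shows "f 0 = 0" "f 1 = 1" "f (a + b) = f a + f b" "f (a * b) = f a * f b"
  using assms by (simp_all add: is_ring_hom_def)

lemma is_ring_hom_sum: "is_ring_hom f \<Longrightarrow> f (sum g A) = (\<Sum>i\<in>A. f (g i))"
  by (induction A rule: infinite_finite_induct) (simp_all add: is_ring_homD)

lemma is_ring_hom_prod: "is_ring_hom f \<Longrightarrow> f (prod g A) = (\<Prod>i\<in>A. f (g i))"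
  by (induction A rule: infinite_finite_induct) (simp_all add: is_ring_homD)

lemma is_ring_hom_power: "is_ring_hom f \<Longrightarrow> f (a ^ n) = f a ^ n"
  by (induction n) (simp_all add: is_ring_homD)

definition var :: "'v \<Rightarrow> (('v \<Rightarrow>\<^sub>0 nat) \<Rightarrow>\<^sub>0 'a::comm_ring_1)" where
  "var v = Poly_Mapping.single (Poly_Mapping.single v 1) 1"

definition monom_eval :: "('v \<Rightarrow> 'q::comm_ring_1) \<Rightarrow> ('v \<Rightarrow>\<^sub>0 nat) \<Rightarrow> 'q" where
  "monom_eval f \<mu> = (\<Prod>v\<in>Poly_Mapping.keys \<mu>. f v ^ Poly_Mapping.lookup \<mu> v)"

text \<open>The coefficients get a map of their own, because the arc takes values in power series
  over power series.\<close>

definition poly_eval ::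
  "('a::comm_ring_1 \<Rightarrow> 'q::comm_ring_1) \<Rightarrow> ('v \<Rightarrow> 'q) \<Rightarrow> (('v \<Rightarrow>\<^sub>0 nat) \<Rightarrow>\<^sub>0 'a) \<Rightarrow> 'q" where
  "poly_eval \<kappa> f p = (\<Sum>\<mu>\<in>Poly_Mapping.keys p. \<kappa> (Poly_Mapping.lookup p \<mu>) * monom_eval f \<mu>)"

lemma monom_eval_superset:
  assumes "finite A" "Poly_Mapping.keys \<mu> \<subseteq> A"
  shows "monom_eval f \<mu> = (\<Prod>v\<in>A. f v ^ Poly_Mapping.lookup \<mu> v)"
  unfolding monom_eval_def
  using assms by (intro prod.mono_neutral_left) (auto simp: in_keys_iff)

lemma monom_eval_add: "monom_eval f (\<mu> + \<nu>) = monom_eval f \<mu> * monom_eval f \<nu>"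
proof -
  let ?A = "Poly_Mapping.keys \<mu> \<union> Poly_Mapping.keys \<nu>"
  have "monom_eval f (\<mu> + \<nu>) = (\<Prod>v\<in>?A. f v ^ Poly_Mapping.lookup (\<mu> + \<nu>) v)"
    by (rule monom_eval_superset) (simp_all add: Poly_Mapping.keys_add)
  also have "\<dots> = (\<Prod>v\<in>?A. f v ^ Poly_Mapping.lookup \<mu> v) * (\<Prod>v\<in>?A. f v ^ Poly_Mapping.lookup \<nu> v)"
    by (simp add: lookup_add power_add prod.distrib)
  also have "\<dots> = monom_eval f \<mu> * monom_eval f \<nu>"
    by (simp add: monom_eval_superset[of ?A])
  finally show ?thesis .
qed

lemma poly_eval_superset:
  assumes "\<kappa> 0 = 0" "finite A" "Poly_Mapping.keys p \<subseteq> A"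
  shows "poly_eval \<kappa> f p = (\<Sum>\<mu>\<in>A. \<kappa> (Poly_Mapping.lookup p \<mu>) * monom_eval f \<mu>)"
  unfolding poly_eval_def
  using assms by (intro sum.mono_neutral_left) (auto simp: in_keys_iff)

lemma poly_eval_add:
  assumes "is_ring_hom \<kappa>"
  shows "poly_eval \<kappa> f (p + q) = poly_eval \<kappa> f p + poly_eval \<kappa> f q"
proof -
  let ?A = "Poly_Mapping.keys p \<union> Poly_Mapping.keys q"
  have *: "poly_eval \<kappa> f r = (\<Sum>\<mu>\<in>?A. \<kappa> (Poly_Mapping.lookup r \<mu>) * monom_eval f \<mu>)"
    if "Poly_Mapping.keys r \<subseteq> ?A" for r
    using that by (intro poly_eval_superset) (auto simp: is_ring_homD[OF assms])
  show ?thesis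
    by (subst (1 2 3) *)
      (auto simp: Poly_Mapping.keys_add lookup_add is_ring_homD[OF assms] algebra_simps sum.distrib)
qed

lemma poly_eval_single:
  "\<kappa> 0 = 0 \<Longrightarrow> poly_eval \<kappa> f (Poly_Mapping.single \<mu> c) = \<kappa> c * monom_eval f \<mu>"
  by (subst poly_eval_superset[where A = "{\<mu>}"]) auto

lemma poly_mapping_sum_singles:
  "p = (\<Sum>\<mu>\<in>Poly_Mapping.keys p. Poly_Mapping.single \<mu> (Poly_Mapping.lookup p \<mu>))"
  by (rule poly_mapping_eqI) (auto simp: lookup_sum lookup_single when_def in_keys_iff)

lemma poly_eval_sum:
  assumes "is_ring_hom \<kappa>"
  shows "poly_eval \<kappa> f (sum g A) = (\<Sum>i\<in>A. poly_eval \<kappa> f (g i))"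
  by (induction A rule: infinite_finite_induct)
    (simp_all add: poly_eval_add[OF assms], simp_all add: poly_eval_def)

lemma poly_eval_hom:
  assumes "is_ring_hom \<kappa>"
  shows "is_ring_hom (poly_eval \<kappa> f)"
proof -
  note hom = is_ring_homD[OF assms]
  have zero: "poly_eval \<kappa> f 0 = 0" by (simp add: poly_eval_def)
  have one: "poly_eval \<kappa> f 1 = 1"
    using poly_eval_single[of \<kappa> f 0 1] by (simp add: hom monom_eval_def)
  have "poly_eval \<kappa> f (p * q) = poly_eval \<kappa> f p * poly_eval \<kappa> f q" for p q
  proof -
    have "p * q = (\<Sum>\<mu>\<in>Poly_Mapping.keys p. Poly_Mapping.single \<mu> (Poly_Mapping.lookup p \<mu>)) *
        (\<Sum>\<nu>\<in>Poly_Mapping.keys q. Poly_Mapping.single \<nu> (Poly_Mapping.lookup q \<nu>))"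
      using poly_mapping_sum_singles[of p] poly_mapping_sum_singles[of q] by simp
    also have "\<dots> = (\<Sum>\<mu>\<in>Poly_Mapping.keys p. \<Sum>\<nu>\<in>Poly_Mapping.keys q.
        Poly_Mapping.single (\<mu> + \<nu>) (Poly_Mapping.lookup p \<mu> * Poly_Mapping.lookup q \<nu>))"
      by (simp add: sum_product mult_single)
    finally have "poly_eval \<kappa> f (p * q) = (\<Sum>\<mu>\<in>Poly_Mapping.keys p. \<Sum>\<nu>\<in>Poly_Mapping.keys q.
        \<kappa> (Poly_Mapping.lookup p \<mu> * Poly_Mapping.lookup q \<nu>) * monom_eval f (\<mu> + \<nu>))"
      by (simp add: poly_eval_sum[OF assms] poly_eval_single hom)
    also have "\<dots> = poly_eval \<kappa> f p * poly_eval \<kappa> f q"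
      unfolding poly_eval_def sum_product by (intro sum.cong refl) (simp add: hom monom_eval_add algebra_simps)
    finally show ?thesis .
  qed
  then show ?thesis using zero one by (simp add: is_ring_hom_def poly_eval_add[OF assms])
qed

lemma poly_eval_var: "is_ring_hom \<kappa> \<Longrightarrow> poly_eval \<kappa> f (var v) = f v"
  by (simp add: var_def poly_eval_single is_ring_homD monom_eval_def)

lemma hom_poly_eval:
  "is_ring_hom h \<Longrightarrow> h (poly_eval \<kappa> f p) = poly_eval (\<lambda>c. h (\<kappa> c)) (\<lambda>v. h (f v)) p"
  by (simp add: poly_eval_def monom_eval_def is_ring_hom_sum is_ring_homD is_ring_hom_prod is_ring_hom_power)

lemma is_ring_hom_single_0: "is_ring_hom (Poly_Mapping.single 0 :: 'a \<Rightarrow> (('v \<Rightarrow>\<^sub>0 nat) \<Rightarrow>\<^sub>0 'a::comm_ring_1))"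
  by (simp add: is_ring_hom_def single_add mult_single)

lemma monom_eval_var: "monom_eval var \<mu> = (Poly_Mapping.single \<mu> 1 :: ('v \<Rightarrow>\<^sub>0 nat) \<Rightarrow>\<^sub>0 'a::comm_ring_1)"
proof -
  have pow: "var v ^ n = (Poly_Mapping.single (Poly_Mapping.single v n) 1 :: ('v \<Rightarrow>\<^sub>0 nat) \<Rightarrow>\<^sub>0 'a)" for v n
    by (induction n) (simp_all add: var_def mult_single single_add[symmetric])
  have "(\<Prod>v\<in>A. Poly_Mapping.single (g v) 1) = (Poly_Mapping.single (sum g A) 1 :: ('v \<Rightarrow>\<^sub>0 nat) \<Rightarrow>\<^sub>0 'a)"
    for g and A :: "'v set"
    by (induction A rule: infinite_finite_induct) (simp_all add: mult_single)
  then show ?thesis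
    using poly_mapping_sum_singles[of \<mu>] by (simp add: monom_eval_def pow)
qed

lemma poly_eval_id: "poly_eval (Poly_Mapping.single 0) var p = p"
  using poly_mapping_sum_singles[of p] by (simp add: poly_eval_def monom_eval_var mult_single)

lemma idl_cong_mult:
  assumes "idl.subspace N" "x - x' \<in> N" "y - y' \<in> N"
  shows "x * y - x' * y' \<in> N"
proof -
  have "x * y - x' * y' = y * (x - x') + x' * (y - y')" by (simp add: algebra_simps)
  then show ?thesis using assms by (metis idl.subspace_add idl.subspace_scale)
qed

lemma idl_cong_prod:
  assumes "idl.subspace N" "\<And>i. i \<in> A \<Longrightarrow> f i - g i \<in> N"
  shows "prod f A - prod g A \<in> N"
  using assms(2)
  by (induction A rule: infinite_finite_induct)
    (simp_all add: idl.subspace_0[OF assms(1)] idl_cong_mult[OF assms(1)])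

text \<open>Used to compare the arc at its origin with the identity, which is itself an evaluation
  by \<open>poly_eval_id\<close>.\<close>

lemma poly_eval_cong_idl:
  assumes N: "idl.subspace N" and f: "\<And>v. f v - g v \<in> N"
  shows "poly_eval \<kappa> f p - poly_eval \<kappa> g p \<in> N"
proof -
  have pow: "f v ^ n - g v ^ n \<in> N" for v n
    using idl_cong_prod[OF N, of "{..<n}" "\<lambda>_. f v" "\<lambda>_. g v"] f by simp
  show ?thesis
    unfolding poly_eval_def sum_subtractf[symmetric] monom_eval_def
    by (intro idl.subspace_sum[OF N] idl_cong_mult[OF N] idl_cong_prod[OF N] pow)
      (simp add: idl.subspace_0[OF N])
qed

subsection \<open>The diagonal ideal has no proper reduction\<close>

lemma subspace_finite_combination:
  assumes "idl.subspace K" "finite H" "f \<in> idl.span (prods K H)"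
  shows "\<exists>j. (\<forall>h. j h \<in> K) \<and> f = (\<Sum>h\<in>H. j h * h)"
  using assms(3)
proof (induction rule: idl.span_induct_alt)
  case base
  then show ?case by (intro exI[of _ "\<lambda>_. 0"]) (simp add: idl.subspace_0[OF assms(1)])
next
  case (step c p f)
  then obtain j where j: "\<forall>h. j h \<in> K" "f = (\<Sum>h\<in>H. j h * h)" by blast
  obtain a h0 where a: "a \<in> K" "h0 \<in> H" "p = a * h0" using step by (auto simp: prods_def)
  define j' where "j' h = (if h = h0 then c * a else 0) + j h" for h
  have "\<forall>h. j' h \<in> K"
    using a j by (auto simp: j'_def intro: idl.subspace_add[OF assms(1)] idl.subspace_scale[OF assms(1)])
  moreover have "(\<Sum>h\<in>H. (if h = h0 then c * a else 0) * h) = (\<Sum>h\<in>H. if h = h0 then c * a * h else 0)"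
    by (intro sum.cong) auto
  then have "c * p + f = (\<Sum>h\<in>H. j' h * h)"
    using a j assms(2) by (simp add: j'_def distrib_right sum.distrib mult.assoc)
  ultimately show ?case by blast
qed

text \<open>Zorn's lemma applies because \<open>D\<close> is finite: the union of a chain contains
  \<open>D\<close> only if a member does. Maximality makes the quotient by \<open>K\<close> a simple
  module, generated by \<open>d\<close> and isomorphic to R/Q, where \<open>Q\<close> is the
  annihilator of \<open>d\<close>. The last three conclusions say so in terms of elements.\<close>

lemma maximal_subideal:
  fixes D :: "'p::comm_ring_1 set"
  assumes "finite D" "idl.subspace J0" "J0 \<subseteq> idl.span D" "\<not> idl.span D \<subseteq> J0"
  shows "\<exists>K d. idl.subspace K \<and> J0 \<subseteq> K \<and> K \<subseteq> idl.span D \<and> d \<in> D \<and> d \<notin> K \<and>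
    prime_idl {a. a * d \<in> K} \<and> (\<forall>a. a * d \<notin> K \<longrightarrow> (\<exists>b. (a * b - 1) * d \<in> K)) \<and>
    (\<forall>f\<in>idl.span D. \<exists>c. f - c * d \<in> K)"
proof -
  define A where "A = {K. idl.subspace K \<and> J0 \<subseteq> K \<and> K \<subseteq> idl.span D \<and> \<not> D \<subseteq> K}"
  have "J0 \<in> A" using assms idl.span_minimal[of D J0] by (auto simp: A_def)
  moreover have "\<Union>C \<in> A" if C: "C \<noteq> {}" "subset.chain A C" for C
  proof -
    have CA: "C \<subseteq> A" and lin: "\<And>S T. S \<in> C \<Longrightarrow> T \<in> C \<Longrightarrow> S \<subseteq> T \<or> T \<subseteq> S"
      using C(2) by (auto simp: subset.chain_def)
    have "idl.subspace (\<Union>C)"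
    proof (rule idl.subspaceI)
      show "0 \<in> \<Union>C" using C(1) CA by (auto simp: A_def idl.subspace_def)
      fix x y assume "x \<in> \<Union>C" "y \<in> \<Union>C"
      then obtain S T where "x \<in> S" "y \<in> T" "S \<in> C" "T \<in> C" by blast
      then obtain U where "x \<in> U" "y \<in> U" "U \<in> C" using lin[of S T] by blast
      moreover from this have "idl.subspace U" using CA by (auto simp: A_def)
      ultimately show "x + y \<in> \<Union>C" using idl.subspace_add by blast
    next
      fix c x assume "x \<in> \<Union>C"
      then obtain U where "x \<in> U" "U \<in> C" by blast
      moreover from this have "idl.subspace U" using CA by (auto simp: A_def)
      ultimately show "c * x \<in> \<Union>C" using idl.subspace_scale by blast
    qed
    moreover have "\<not> D \<subseteq> \<Union>C"
    proof
      assume "D \<subseteq> \<Union>C"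
      then obtain S where "S \<in> C" "D \<subseteq> S"
        using finite_subset_Union_chain[OF assms(1) _ C] by metis
      then show False using CA by (auto simp: A_def)
    qed
    ultimately show ?thesis using C(1) CA by (auto simp: A_def)
  qed
  ultimately obtain K where KA: "K \<in> A" and max: "\<And>S. S \<in> A \<Longrightarrow> K \<subseteq> S \<Longrightarrow> S = K"
    using subset_Zorn_nonempty[of A] by blast
  have K: "idl.subspace K" "J0 \<subseteq> K" "K \<subseteq> idl.span D" "\<not> D \<subseteq> K" using KA by (auto simp: A_def)
  obtain d where d: "d \<in> D" "d \<notin> K" using K(4) by blast
  \<comment> \<open>Together with \<open>K\<close>, any element outside \<open>K\<close> generates
    everything.\<close>
  have ext: "\<exists>c. g - c * f \<in> K" if f: "f \<in> idl.span D" "f \<notin> K" and g: "g \<in> idl.span D" for f g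
  proof -
    let ?S = "idl.span (insert f K)"
    have spanK: "idl.span K = K" using K(1) by simp
    have mem: "x \<in> ?S \<longleftrightarrow> (\<exists>c. x - c * f \<in> K)" for x
      using idl.span_breakdown_eq[of x f K] unfolding spanK .
    have "K \<subseteq> ?S" "f \<in> ?S" using idl.span_superset[of "insert f K"] by auto
    then have "?S \<notin> A" using max f by blast
    moreover have "?S \<subseteq> idl.span D" using f K by (intro idl.span_minimal) auto
    ultimately have "D \<subseteq> ?S" using K \<open>K \<subseteq> ?S\<close> by (auto simp: A_def)
    then have "g \<in> ?S" using g idl.span_minimal[of D ?S] by auto
    then show ?thesis using mem by blast
  qed
  have dD: "d \<in> idl.span D" using d by (simp add: idl.span_base)
  have unit: "\<exists>b. (a * b - 1) * d \<in> K" if ad: "a * d \<notin> K" for a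
  proof -
    obtain c where "d - c * (a * d) \<in> K" using ext[OF idl.span_scale[OF dD] ad dD] by blast
    then have "- (d - c * (a * d)) \<in> K" by (rule idl.subspace_neg[OF K(1)])
    then have "(a * c - 1) * d \<in> K" by (simp add: algebra_simps)
    then show ?thesis by blast
  qed
  have "prime_idl {a. a * d \<in> K}"
    unfolding prime_idl_def
  proof (intro conjI allI impI)
    show "idl.subspace {a. a * d \<in> K}"
      using K(1) by (auto simp: idl.subspace_def distrib_right mult.assoc)
    show "1 \<notin> {a. a * d \<in> K}" using d by simp
    fix a b assume ab: "a * b \<in> {a. a * d \<in> K}"
    show "a \<in> {a. a * d \<in> K} \<or> b \<in> {a. a * d \<in> K}"
    proof (rule ccontr)
      assume n: "\<not> ?thesis"
      then obtain c where c: "(a * c - 1) * d \<in> K" using unit by blast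
      have "b * d = c * (a * b * d) - b * ((a * c - 1) * d)" by (simp add: algebra_simps)
      also have "\<dots> \<in> K" using ab c K(1) by (auto intro: idl.subspace_diff idl.subspace_scale)
      finally show False using n by simp
    qed
  qed
  then show ?thesis using K d unit ext[OF dD d(2)] by blast
qed

text \<open>Near \<open>Q\<close>, \<open>X i0\<close> is a unit if the row is not empty, so the
  ideal of all cells contains every \<open>Y t\<close> of this row; the claim is that the diagonals
  suffice. The diagonal through (i0, t) expresses \<open>X i0 * Y t\<close> by cells of earlier
  rows, whose \<open>X s\<close> lie in \<open>Q\<close>, and by cells in later columns of the row.
  Descending induction on t reduces the claim to Nakayama's lemma.\<close>

lemma row_in_saturation:
  fixes X Y :: "nat \<Rightarrow> 'p::comm_ring_1"
  assumes L: "young_diagram L" and Q: "prime_idl Q" and J: "idl.subspace J"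
    and D: "\<And>k. diag_sum L X Y k \<in> J"
    and small: "\<And>s. 1 \<le> s \<Longrightarrow> s < i0 \<Longrightarrow> X s \<in> Q"
    and unit: "\<And>t. (i0, t) \<in> L \<Longrightarrow> X i0 \<notin> Q"
  shows "\<exists>u. u \<notin> Q \<and> (\<forall>t. (i0, t) \<in> L \<longrightarrow> u * Y t \<in> J)"
proof -
  define T where "T = {t. (i0, t) \<in> L}"
  have finL: "finite L" using L by (simp add: young_diagram_def)
  have "T = snd ` (L \<inter> {i0} \<times> UNIV)" by (force simp: T_def)
  then have finT: "finite T" using finL by simp
  have subQ: "idl.subspace Q" using Q by (rule prime_idl_subspace)
  \<comment> \<open>The ideal \<open>J\<close> plus \<open>Q\<close> times the \<open>Y l\<close> of
    the row, in the form required by Nakayama's lemma.\<close>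
  define W where "W = {z. \<exists>h. (\<forall>l\<in>T. h l \<in> Q) \<and> z - (\<Sum>l\<in>T. h l * Y l) \<in> J}"
  have subW: "idl.subspace W"
  proof (rule idl.subspaceI)
    show "0 \<in> W" using idl.subspace_0[OF J] idl.subspace_0[OF subQ]
      by (auto simp: W_def intro!: exI[of _ "\<lambda>_. 0"])
    fix x y assume "x \<in> W" "y \<in> W"
    then obtain h h' where h: "\<forall>l\<in>T. h l \<in> Q" "x - (\<Sum>l\<in>T. h l * Y l) \<in> J"
      "\<forall>l\<in>T. h' l \<in> Q" "y - (\<Sum>l\<in>T. h' l * Y l) \<in> J" by (auto simp: W_def)
    have "x + y - (\<Sum>l\<in>T. (h l + h' l) * Y l) = (x - (\<Sum>l\<in>T. h l * Y l)) + (y - (\<Sum>l\<in>T. h' l * Y l))"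
      by (simp add: distrib_right sum.distrib)
    also have "\<dots> \<in> J" using h by (intro idl.subspace_add[OF J])
    finally show "x + y \<in> W" using h idl.subspace_add[OF subQ]
      by (auto simp: W_def intro!: exI[of _ "\<lambda>l. h l + h' l"])
  next
    fix c x assume "x \<in> W"
    then obtain h where h: "\<forall>l\<in>T. h l \<in> Q" "x - (\<Sum>l\<in>T. h l * Y l) \<in> J" by (auto simp: W_def)
    have "c * x - (\<Sum>l\<in>T. (c * h l) * Y l) = c * (x - (\<Sum>l\<in>T. h l * Y l))"
      by (simp add: right_diff_distrib sum_distrib_left mult.assoc)
    also have "\<dots> \<in> J" using h by (intro idl.subspace_scale[OF J])
    finally show "c * x \<in> W" using h idl.subspace_scale[OF subQ]
      by (auto simp: W_def intro!: exI[of _ "\<lambda>l. c * h l"])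
  qed
  have JW: "z \<in> W" if "z \<in> J" for z
    using that idl.subspace_0[OF subQ] by (auto simp: W_def intro!: exI[of _ "\<lambda>_. 0"])
  have QW: "q * Y t \<in> W" if "q \<in> Q" "t \<in> T" for q t
  proof -
    have "(\<Sum>l\<in>T. (if l = t then q else 0) * Y l) = (\<Sum>l\<in>T. if l = t then q * Y l else 0)"
      by (intro sum.cong) auto
    then have "q * Y t - (\<Sum>l\<in>T. (if l = t then q else 0) * Y l) = 0" using that finT by simp
    then show ?thesis using that idl.subspace_0[OF subQ] idl.subspace_0[OF J]
      by (auto simp: W_def intro!: exI[of _ "\<lambda>l. if l = t then q else 0"])
  qed
  \<comment> \<open>One factor \<open>X i0\<close> is spent per column, counted from the right end
    of the row.\<close>
  have pow: "\<forall>t\<in>T. Max T - t < e \<longrightarrow> X i0 ^ e * Y t \<in> W" for e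
  proof (induction e)
    case (Suc e)
    show ?case
    proof (intro ballI impI)
      fix t assume t: "t \<in> T" "Max T - t < Suc e"
      let ?k = "cell_diag (i0, t)"
      let ?C = "{c \<in> L. cell_diag c = ?k}"
      have "diag_sum L X Y ?k = X i0 * Y t + (\<Sum>(s, t')\<in>?C - {(i0, t)}. X s * Y t')"
        unfolding diag_sum_def using finL t by (subst sum.remove[of _ "(i0, t)"]) (auto simp: T_def)
      then have "X i0 ^ Suc e * Y t = X i0 ^ e * diag_sum L X Y ?k
          - (\<Sum>c\<in>?C - {(i0, t)}. X i0 ^ e * (case c of (s, t') \<Rightarrow> X s * Y t'))"
        by (simp add: algebra_simps flip: sum_distrib_left)
      also have "\<dots> \<in> W"
      proof (intro idl.subspace_diff[OF subW] idl.subspace_sum[OF subW])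
        show "X i0 ^ e * diag_sum L X Y ?k \<in> W" using D idl.subspace_scale[OF J] JW by blast
        fix c assume c: "c \<in> ?C - {(i0, t)}"
        obtain s t' where st: "c = (s, t')" by (cases c)
        have s: "(s, t') \<in> L" "1 \<le> s" "1 \<le> t'" using c st young_diagram_pos[OF L, of s t'] by auto
        have i0t: "(i0, t) \<in> L" "1 \<le> i0" using t young_diagram_pos[OF L, of i0 t] by (auto simp: T_def)
        have "s \<noteq> i0" using c st by (auto simp: cell_diag_def)
        moreover have "int t' - int s = int t - int i0" using c st by (simp add: cell_diag_def)
        ultimately have "s < i0 \<and> t' < t \<or> i0 < s \<and> t < t'" by linarith
        then consider "s < i0" "t' < t" | "i0 < s" "t < t'" by blast
        then show "X i0 ^ e * (case c of (s, t') \<Rightarrow> X s * Y t') \<in> W"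
        proof cases
          case 1
          then have "t' \<in> T" using young_diagram_down[OF L i0t(1)] s i0t by (auto simp: T_def)
          then have "X s * Y t' \<in> W" using QW small 1 s by blast
          then show ?thesis using st idl.subspace_scale[OF subW] by simp
        next
          case 2
          then have t': "t' \<in> T" using young_diagram_down[OF L s(1)] s i0t by (auto simp: T_def)
          then have "t' \<le> Max T" using finT by simp
          then have "Max T - t' < e" using t 2 by linarith
          then have "X i0 ^ e * Y t' \<in> W" using Suc t' by blast
          then have "X s * (X i0 ^ e * Y t') \<in> W" using idl.subspace_scale[OF subW] by blast
          then show ?thesis using st by (simp add: algebra_simps)
        qed
      qed
      finally show "X i0 ^ Suc e * Y t \<in> W" .
    qed
  qed simp
  have "\<exists>a. a \<notin> Q \<and> (\<forall>g\<in>T. a * Y g \<in> J)"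
  proof (rule nakayama_elimination[where act = "\<lambda>a. a" and S = Q and N = J])
    show "\<forall>g\<in>T. \<exists>a h. a \<notin> Q \<and> (\<forall>l\<in>T. h l \<in> Q) \<and> a * Y g - (\<Sum>l\<in>T. h l * Y l) \<in> J"
    proof
      fix t assume t: "t \<in> T"
      then have "X i0 ^ Suc (Max T) * Y t \<in> W" using pow[of "Suc (Max T)"] by auto
      moreover have "X i0 ^ Suc (Max T) \<notin> Q"
        using unit t by (intro prime_idl_power[OF Q]) (auto simp: T_def)
      ultimately show "\<exists>a h. a \<notin> Q \<and> (\<forall>l\<in>T. h l \<in> Q) \<and> a * Y t - (\<Sum>l\<in>T. h l * Y l) \<in> J"
        by (auto simp: W_def)
    qed
  qed (use Q finT J in \<open>auto intro: idl.subspace_add idl.subspace_0 idl.subspace_scale\<close>)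
  then show ?thesis by (auto simp: T_def)
qed

text \<open>Transposition exchanges the two kinds of variables, so that what is shown for a row also
  holds for a column.\<close>

lemma diag_sum_converse: "diag_sum (L\<inverse>) Y X (- k) = diag_sum L X Y k"
proof -
  have "{c \<in> L\<inverse>. cell_diag c = - k} = prod.swap ` {c \<in> L. cell_diag c = k}"
    by (force simp: cell_diag_def image_iff)
  then show ?thesis
    unfolding diag_sum_def by (simp add: sum.reindex case_prod_unfold mult.commute)
qed

lemma young_diagram_converse: "young_diagram L \<Longrightarrow> young_diagram (L\<inverse>)"
  unfolding young_diagram_def finite_converse converse_iff by blast

text \<open>Orders add and leading coefficients multiply. Only lower bounds of the orders are known,
  so the coefficients at \<open>a\<close> and \<open>b\<close> may vanish.\<close>

lemma fps_X_power_dvd_mult: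
  fixes f g :: "'q::comm_ring_1 fps"
  assumes "fps_X ^ a dvd f" "fps_X ^ b dvd g"
  shows "fps_X ^ (a + b) dvd f * g" "fps_nth (f * g) (a + b) = fps_nth f a * fps_nth g b"
proof -
  obtain f' g' where fg: "f = fps_X ^ a * f'" "g = fps_X ^ b * g'" using assms by (auto elim!: dvdE)
  have eq: "f * g = fps_X ^ (a + b) * (f' * g')" by (simp add: fg power_add algebra_simps)
  show "fps_X ^ (a + b) dvd f * g" unfolding eq by simp
  show "fps_nth (f * g) (a + b) = fps_nth f a * fps_nth g b"
    unfolding eq by (simp add: fps_X_power_mult_nth fg)
qed

lemma fps_nth_mult_dvd:
  fixes f g :: "'q::comm_ring_1 fps"
  assumes "fps_X ^ b dvd g"
  shows "fps_nth (f * g) b = fps_nth f 0 * fps_nth g b"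
  using fps_X_power_dvd_mult(2)[of 0 f b g] assms by simp

text \<open>The value at 1 is the sum of the coefficients. Used in contrapositive form: a value
  outside \<open>Q\<close> shows that the power series is nonzero modulo \<open>Q\<close>.\<close>

lemma fps_of_poly_in_fps_idl:
  assumes "idl.subspace Q" "fps_of_poly F \<in> fps_idl Q"
  shows "poly F 1 \<in> Q"
  using assms(2) unfolding poly_altdef
  by (intro idl.subspace_sum[OF assms(1)]) (simp add: fps_idl_def)

lemma prime_idl_eval_1:
  assumes "prime_idl Q"
  shows "prime_idl {F. poly F 1 \<in> Q}"
proof -
  have sub: "idl.subspace Q" using assms by (rule prime_idl_subspace)
  have "idl.subspace {F. poly F 1 \<in> Q}"
    by (rule idl.subspaceI)
      (simp_all add: idl.subspace_0[OF sub] idl.subspace_add[OF sub] idl.subspace_scale[OF sub])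
  then show ?thesis using assms unfolding prime_idl_def by simp
qed

lemma diag_sum_no_proper_reduction:
  fixes L :: "(nat \<times> nat) set"
    and J0 :: "(((nat + nat) \<Rightarrow>\<^sub>0 nat) \<Rightarrow>\<^sub>0 'a::comm_ring_1) set"
  defines "x \<equiv> \<lambda>i. var (Inl i)" and "y \<equiv> \<lambda>j. var (Inr j)"
  assumes L: "young_diagram L" and J0: "idl.subspace J0"
    and J0_sub: "J0 \<subseteq> idl.span (range (diag_sum L x y))"
    and red: "pow_gens (gens L x y) (Suc r) \<subseteq> idl.span (prods J0 (pow_gens (gens L x y) r))"
  shows "idl.span (range (diag_sum L x y)) \<subseteq> J0"
proof (rule ccontr)
  assume not_sub: "\<not> ?thesis"

  \<comment> \<open>A maximal proper subideal of J and its linear form\<close>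
  define d where "d = diag_sum L x y"
  define J where "J = idl.span (range d)"
  define G where "G = gens L x y"
  have finL: "finite L" using L by (simp add: young_diagram_def)
  have finG: "finite G" using finL by (simp add: G_def gens_def)
  have fin: "finite (range d)"
  proof (rule finite_subset)
    show "range d \<subseteq> insert 0 (d ` (cell_diag ` L))"
    proof
      fix z assume "z \<in> range d"
      then obtain k where k: "z = d k" by blast
      show "z \<in> insert 0 (d ` (cell_diag ` L))"
      proof (cases "k \<in> cell_diag ` L")
        case False
        then have none: "{c \<in> L. cell_diag c = k} = {}" by auto
        have "d k = 0" unfolding d_def diag_sum_def none by simp
        then show ?thesis by (simp add: k)
      qed (simp add: k)
    qed
  qed (use finL in simp)
  obtain K d0 where *: "idl.subspace K \<and> J0 \<subseteq> K \<and> K \<subseteq> idl.span (range d) \<and> d0 \<in> range d \<and> d0 \<notin> K \<and>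
      prime_idl {a. a * d0 \<in> K} \<and> (\<forall>a. a * d0 \<notin> K \<longrightarrow> (\<exists>b. (a * b - 1) * d0 \<in> K)) \<and>
      (\<forall>f\<in>idl.span (range d). \<exists>c. f - c * d0 \<in> K)"
    using maximal_subideal[OF fin J0 J0_sub[folded d_def] not_sub[folded d_def]] by (elim exE)
  then have K: "idl.subspace K" "J0 \<subseteq> K" "K \<subseteq> J" "d0 \<in> range d" "d0 \<notin> K"
    and prime: "prime_idl {a. a * d0 \<in> K}"
    unfolding J_def by blast+
  have units: "\<exists>b. (a * b - 1) * d0 \<in> K" if "a * d0 \<notin> K" for a
    using * that by blast
  have cyclic: "\<exists>c. f - c * d0 \<in> K" if "f \<in> J" for f
    using * that unfolding J_def by blast
  obtain k0 where k0: "d0 = d k0" using K by blast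
  define Q where "Q = {a. a * d0 \<in> K}"
  have Q: "prime_idl Q" using prime by (simp add: Q_def)
  have subQ: "idl.subspace Q" using Q by (rule prime_idl_subspace)
  (* phi represents the linear form J --> J/K = R/Q that sends d0 to 1. *)
  define \<phi> where "\<phi> f = (SOME c. f - c * d0 \<in> K)" for f
  have \<phi>: "f - \<phi> f * d0 \<in> K" if "f \<in> J" for f
    unfolding \<phi>_def by (rule someI_ex) (rule cyclic[OF that])
  have \<phi>_unique: "\<phi> f - c \<in> Q" if "f \<in> J" "f - c * d0 \<in> K" for f c
  proof -
    have "(\<phi> f - c) * d0 = (f - c * d0) - (f - \<phi> f * d0)" by (simp add: algebra_simps)
    also have "\<dots> \<in> K" by (rule idl.subspace_diff[OF K(1) that(2) \<phi>[OF that(1)]])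
    finally show ?thesis by (simp add: Q_def)
  qed
  have subJ: "idl.subspace J" by (simp add: J_def)
  have dJ: "d k \<in> J" for k by (simp add: J_def idl.span_base)
  have \<phi>_lin: "\<phi> (\<Sum>i\<in>A. c i * f i) - (\<Sum>i\<in>A. c i * \<phi> (f i)) \<in> Q"
    if f: "\<And>i. i \<in> A \<Longrightarrow> f i \<in> J" for c f and A :: "(nat \<times> nat) set"
  proof (rule \<phi>_unique)
    show "(\<Sum>i\<in>A. c i * f i) \<in> J"
      by (rule idl.subspace_sum[OF subJ]) (rule idl.subspace_scale[OF subJ f])
    have "(\<Sum>i\<in>A. c i * f i) - (\<Sum>i\<in>A. c i * \<phi> (f i)) * d0 = (\<Sum>i\<in>A. c i * (f i - \<phi> (f i) * d0))"
      by (simp add: right_diff_distrib sum_subtractf sum_distrib_right mult.assoc)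
    also have "\<dots> \<in> K" 
      by (rule idl.subspace_sum[OF K(1)]) (rule idl.subspace_scale[OF K(1) \<phi>[OF f]])
    finally show "(\<Sum>i\<in>A. c i * f i) - (\<Sum>i\<in>A. c i * \<phi> (f i)) * d0 \<in> K" .
  qed
  have \<phi>_K: "\<phi> f \<in> Q" if "f \<in> K" for f
    using \<phi>_unique[of f 0] that K by auto
  have \<phi>_d0: "\<phi> d0 - 1 \<in> Q"
    using \<phi>_unique[of d0 1] k0 dJ idl.subspace_0[OF K(1)] by simp
  have KQ: "f \<in> Q" if "f \<in> K" for f
    using idl.subspace_scale[OF K(1) that, of d0] by (simp add: Q_def mult.commute)
  \<comment> \<open>A power of each generator lies in \<open>K\<close>, hence in \<open>Q\<close>:
    an ideal and its reduction have the same radical.\<close>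
  have GQ: "g \<in> Q" if "g \<in> G" for g
  proof (rule ccontr)
    assume "g \<notin> Q"
    then have "g ^ Suc r \<notin> Q" by (rule prime_idl_power[OF Q])
    moreover have "{g} \<subseteq> G" using that by simp
    then have "pow_gens {g} (Suc r) \<subseteq> pow_gens G (Suc r)" by (rule pow_gens_mono)
    then have "g ^ Suc r \<in> pow_gens G (Suc r)" by (simp add: pow_gens_singleton)
    then have "g ^ Suc r \<in> idl.span (prods J0 (pow_gens G r))" using red by (auto simp: G_def)
    moreover have "idl.span (prods J0 (pow_gens G r)) \<subseteq> K"
    proof (rule idl.span_minimal[OF _ K(1)])
      show "prods J0 (pow_gens G r) \<subseteq> K"
        using K(2) idl.subspace_scale[OF K(1)] by (auto simp: prods_def) (metis mult.commute subsetD)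
    qed
    ultimately show False using KQ by blast
  qed

  \<comment> \<open>The shape of the ideal I near the point of Q\<close>
  obtain n where n: "\<And>i j. (i, j) \<in> L \<Longrightarrow> i < n \<and> j < n"
  proof
    fix i j assume "(i, j) \<in> L"
    then have "i \<in> fst ` L" "j \<in> snd ` L" by force+
    then have "i \<le> Max (fst ` L \<union> snd ` L)" "j \<le> Max (fst ` L \<union> snd ` L)"
      using finL by (auto intro!: Max_ge)
    then show "i < Suc (Max (fst ` L \<union> snd ` L)) \<and> j < Suc (Max (fst ` L \<union> snd ` L))" by simp
  qed
  \<comment> \<open>If no variable with index in [1, n) is outside \<open>Q\<close>, the index found
    is at least \<open>n\<close>, beyond the diagram, and the corresponding row or column is
    empty.\<close>
  have first: "\<exists>i\<ge>1. (z i \<notin> Q \<or> n \<le> i) \<and> (\<forall>s. 1 \<le> s \<longrightarrow> s < i \<longrightarrow> z s \<in> Q)" for z :: "nat \<Rightarrow> _"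
  proof -
    let ?P = "\<lambda>i. 1 \<le> i \<and> (z i \<notin> Q \<or> n \<le> i)"
    have "?P (Suc n)" by simp
    then have "?P (Least ?P)" by (rule LeastI)
    moreover have "z s \<in> Q" if "1 \<le> s" "s < Least ?P" for s
      using not_less_Least[OF that(2)] that(1) by auto
    ultimately show ?thesis by blast
  qed
  obtain i0 where i0: "1 \<le> i0" "x i0 \<notin> Q \<or> n \<le> i0" "\<And>s. 1 \<le> s \<Longrightarrow> s < i0 \<Longrightarrow> x s \<in> Q"
    using first[of x] by blast
  obtain j0 where j0: "1 \<le> j0" "y j0 \<notin> Q \<or> n \<le> j0" "\<And>s. 1 \<le> s \<Longrightarrow> s < j0 \<Longrightarrow> y s \<in> Q"
    using first[of y] by blast
  have corner: "(i0, j0) \<notin> L"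
  proof
    assume *: "(i0, j0) \<in> L"
    then have "x i0 \<notin> Q" "y j0 \<notin> Q" using n[OF *] i0 j0 by auto
    then have "x i0 * y j0 \<notin> Q" by (rule prime_idl_mult[OF Q])
    moreover have "x i0 * y j0 \<in> G" using * by (auto simp: G_def gens_def)
    ultimately show False using GQ by blast
  qed
  have "\<exists>u. u \<notin> Q \<and> (\<forall>t. (i0, t) \<in> L \<longrightarrow> u * y t \<in> J)"
  proof (rule row_in_saturation[OF L Q subJ])
    show "diag_sum L x y k \<in> J" for k using dJ by (simp add: d_def)
    show "x i0 \<notin> Q" if "(i0, t) \<in> L" for t using n[OF that] i0 by auto
  qed (use i0 in auto)
  then obtain u1 where u1: "u1 \<notin> Q" "\<And>t. (i0, t) \<in> L \<Longrightarrow> u1 * y t \<in> J" by blast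
  have "\<exists>u. u \<notin> Q \<and> (\<forall>t. (j0, t) \<in> L\<inverse> \<longrightarrow> u * x t \<in> J)"
  proof (rule row_in_saturation[OF young_diagram_converse[OF L] Q subJ])
    show "diag_sum (L\<inverse>) y x k \<in> J" for k using dJ diag_sum_converse[of L y x "- k"] by (simp add: d_def)
    show "y j0 \<notin> Q" if "(j0, t) \<in> L\<inverse>" for t using n[of t j0] that j0 by auto
  qed (use j0 in auto)
  then obtain u2 where u2: "u2 \<notin> Q" "\<And>s. (s, j0) \<in> L \<Longrightarrow> u2 * x s \<in> J" by blast
  define u where "u = u1 * u2"
  have u: "u \<notin> Q" unfolding u_def by (rule prime_idl_mult[OF Q u1(1) u2(1)])
  have uy: "u * y t \<in> J" if "(i0, t) \<in> L" for t
    using idl.subspace_scale[OF subJ u1(2)[OF that], of u2] by (simp add: u_def algebra_simps)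
  have ux: "u * x s \<in> J" if "(s, j0) \<in> L" for s
    using idl.subspace_scale[OF subJ u2(2)[OF that], of u1] by (simp add: u_def algebra_simps)
  obtain w where w: "u * w - 1 \<in> Q" using units[of u] u by (auto simp: Q_def)
  \<comment> \<open>The values of the linear form at y_t and x_s, which lie in \<open>J\<close> only
    after localisation: \<open>u\<close> clears the denominators, and \<open>w\<close> inverts
    \<open>u\<close> modulo \<open>Q\<close>.\<close>
  define \<eta> where "\<eta> t = w * \<phi> (u * y t)" for t
  define \<xi> where "\<xi> s = w * \<phi> (u * x s)" for s
  \<comment> \<open>Near \<open>Q\<close>, the ideal \<open>I\<close> is generated by the y_t of row
    \<open>i0\<close>, the x_s of column \<open>j0\<close> and the cells of \<open>M\<close>. If
    \<open>M\<close> is not empty, its corner is (a, b).\<close>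
  define M where "M = {(s, t) \<in> L. (s, j0) \<notin> L \<and> (i0, t) \<notin> L}"
  define a where "a = (LEAST s. 1 \<le> s \<and> (s, j0) \<notin> L)"
  define b where "b = (LEAST t. 1 \<le> t \<and> (i0, t) \<notin> L)"
  have "1 \<le> i0 \<and> (i0, j0) \<notin> L" using i0 corner by simp
  then have "1 \<le> a \<and> (a, j0) \<notin> L" unfolding a_def by (rule LeastI)
  then have a: "1 \<le> a" "(a, j0) \<notin> L" by auto
  have "1 \<le> j0 \<and> (i0, j0) \<notin> L" using j0 corner by simp
  then have "1 \<le> b \<and> (i0, b) \<notin> L" unfolding b_def by (rule LeastI)
  then have b: "1 \<le> b" "(i0, b) \<notin> L" by auto
  \<comment> \<open>The diagonals of \<open>M\<close> at the point where the variables of row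
    \<open>a\<close> and of column \<open>b\<close> are 1 and all others are 0.\<close>
  define e where "e k = (of_bool (M \<noteq> {} \<and> k = int b - int a) :: ((nat + nat) \<Rightarrow>\<^sub>0 nat) \<Rightarrow>\<^sub>0 'a)" for k
  have M_corner: "a \<le> s \<and> b \<le> t" if "(s, t) \<in> M" for s t
    using that young_diagram_pos[OF L, of s t] unfolding a_def b_def
    by (auto simp: M_def intro!: Least_le)
  have M_down: "(s', t') \<in> M" if st: "(s, t) \<in> M" "a \<le> s'" "s' \<le> s" "b \<le> t'" "t' \<le> t" for s t s' t'
  proof -
    have "(s', t') \<in> L" using young_diagram_down[OF L, of s t s' t'] st a b by (auto simp: M_def)
    moreover have "(s', j0) \<notin> L" using young_diagram_down[OF L, of s' j0 a j0] st a j0 by auto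
    moreover have "(i0, t') \<notin> L" using young_diagram_down[OF L, of i0 t' i0 b] st b i0 by auto
    ultimately show ?thesis by (simp add: M_def)
  qed
  have finM: "finite M" using finL by (rule finite_subset[rotated]) (auto simp: M_def)
  have "\<exists>\<alpha> \<beta>. \<forall>c\<in>M. diag_sum M \<alpha> \<beta> (cell_diag c)
      = of_bool (cell_diag c = int b - int a) + fps_X * fps_const (\<phi> (d (cell_diag c)) - e (cell_diag c))"
    by (rule diag_sum_solvable[OF finM M_corner M_down])
  then obtain \<alpha> \<beta> where \<alpha>\<beta>: "\<And>c. c \<in> M \<Longrightarrow> diag_sum M \<alpha> \<beta> (cell_diag c)
      = of_bool (cell_diag c = int b - int a) + fps_X * fps_const (\<phi> (d (cell_diag c)) - e (cell_diag c))"
    by blast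

  \<comment> \<open>An arc through the point of Q\<close>
  define N where "N = fps_idl Q"
  have N: "prime_idl N" unfolding N_def by (rule prime_fps_idl[OF Q])
  have subN: "idl.subspace N" using N by (rule prime_idl_subspace)
  have constN: "fps_const q \<in> N" if "q \<in> Q" for q
    using that idl.subspace_0[OF subQ] by (auto simp: N_def fps_idl_def)
  (* gamma is an arc, with outer variable t, through the point of the prime Q. All generators have
     order at least 2 in t along it, and modulo Q the coefficient of t^2 in d k is
     tau * phi (d k) + (1 - tau) * e k, where tau is the inner power series variable. *)
  define fx where "fx s = (if x s \<notin> Q then fps_const (fps_const (x s))
      else if (s, j0) \<in> L then fps_X ^ 2 * fps_const (fps_X * fps_const (\<xi> s))
      else fps_X * fps_const (\<alpha> s))" for s
  define fy where "fy t = (if y t \<notin> Q then fps_const (fps_const (y t))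
      else if (i0, t) \<in> L then fps_X ^ 2 * fps_const (fps_X * fps_const (\<eta> t))
      else fps_X * fps_const (\<beta> t))" for t
  define \<kappa> where "\<kappa> c = fps_const (fps_const (Poly_Mapping.single 0 c :: ((nat + nat) \<Rightarrow>\<^sub>0 nat) \<Rightarrow>\<^sub>0 'a))" for c
  define \<gamma> where "\<gamma> = poly_eval \<kappa> (case_sum fx fy)"
  have fps_const_hom: "is_ring_hom (fps_const :: 'q::comm_ring_1 \<Rightarrow> 'q fps)"
    by (simp add: is_ring_hom_def)
  have \<kappa>: "is_ring_hom \<kappa>"
    unfolding \<kappa>_def by (simp add: is_ring_hom_def single_add mult_single)
  have \<gamma>: "is_ring_hom \<gamma>" unfolding \<gamma>_def by (rule poly_eval_hom[OF \<kappa>])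
  note \<gamma>D = is_ring_homD[OF \<gamma>]
  have \<gamma>x: "\<gamma> (x s) = fx s" and \<gamma>y: "\<gamma> (y s) = fy s" for s
    by (simp_all add: \<gamma>_def x_def y_def poly_eval_var[OF \<kappa>])
  \<comment> \<open>At the origin the arc is the identity modulo \<open>N\<close>: variables outside
    \<open>Q\<close> are kept, and those in \<open>Q\<close>, congruent to 0, are sent to 0.\<close>
  have \<gamma>0: "fps_nth (\<gamma> p) 0 - fps_const p \<in> N" for p
  proof -
    have nth0: "is_ring_hom (\<lambda>f :: (((nat + nat) \<Rightarrow>\<^sub>0 nat) \<Rightarrow>\<^sub>0 'a) fps fps. fps_nth f 0)"
      by (simp add: is_ring_hom_def)
    have eq1: "fps_nth (\<gamma> p) 0 = poly_eval (\<lambda>c. fps_const (Poly_Mapping.single 0 c)) (\<lambda>v. fps_nth (case_sum fx fy v) 0) p"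
      unfolding \<gamma>_def by (subst hom_poly_eval[OF nth0]) (simp add: \<kappa>_def)
    have eq2: "fps_const p = poly_eval (\<lambda>c. fps_const (Poly_Mapping.single 0 c)) (\<lambda>v. fps_const (var v)) p"
      using hom_poly_eval[OF fps_const_hom, of "Poly_Mapping.single 0" var p] by (simp add: poly_eval_id)
    have "fps_nth (case_sum fx fy v) 0 - fps_const (var v) \<in> N" for v
    proof (cases v)
      case (Inl s)
      have "- fps_const (x s) \<in> N" if "x s \<in> Q" using idl.subspace_neg[OF subN constN[OF that]] .
      moreover have "var v = x s" by (simp add: Inl x_def)
      ultimately show ?thesis using idl.subspace_0[OF subN]
        by (auto simp: Inl fx_def fps_X_power_mult_nth)
    next
      case (Inr s)
      have "- fps_const (y s) \<in> N" if "y s \<in> Q" using idl.subspace_neg[OF subN constN[OF that]] .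
      moreover have "var v = y s" by (simp add: Inr y_def)
      ultimately show ?thesis using idl.subspace_0[OF subN]
        by (auto simp: Inr fy_def fps_X_power_mult_nth)
    qed
    then show ?thesis unfolding eq1 eq2 by (rule poly_eval_cong_idl[OF subN])
  qed
  have M_less: "s < i0 \<and> t < j0" if "(s, t) \<in> M" for s t
  proof -
    have st: "(s, t) \<in> L" "(s, j0) \<notin> L" "(i0, t) \<notin> L" using that by (auto simp: M_def)
    have "\<not> i0 \<le> s" using young_diagram_down[OF L st(1), of i0 t] young_diagram_pos[OF L st(1)] i0 st by auto
    moreover have "\<not> j0 \<le> t" using young_diagram_down[OF L st(1), of s j0] young_diagram_pos[OF L st(1)] j0 st by auto
    ultimately show ?thesis by simp
  qed
  have col_less: "t < j0" if "(i0, t) \<in> L" for t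
    using young_diagram_down[OF L that, of i0 j0] corner i0 j0 by (cases "t < j0") auto
  have row_less: "s < i0" if "(s, j0) \<in> L" for s
    using young_diagram_down[OF L that, of i0 j0] corner i0 j0 by (cases "s < i0") auto
  \<comment> \<open>The coefficient of t^2 at each cell, modulo \<open>N\<close>. Variables that are
    generators near \<open>Q\<close> have order at least 2 along the arc, those of the cells of
    \<open>M\<close> order at least 1, so that both kinds of generators start in the same
    degree.\<close>
  define val where "val = (\<lambda>(s, t). if (i0, t) \<in> L then fps_X * fps_const (x s * \<eta> t)
      else if (s, j0) \<in> L then fps_X * fps_const (\<xi> s * y t) else \<alpha> s * \<beta> t)"
  have cell: "fps_X ^ 2 dvd \<gamma> (x s * y t) \<and> fps_nth (\<gamma> (x s * y t)) 2 - val (s, t) \<in> N"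
    if st: "(s, t) \<in> L" for s t
  proof -
    have pos: "1 \<le> s" "1 \<le> t" using young_diagram_pos[OF L st] by auto
    consider (col) "(i0, t) \<in> L" | (row) "(i0, t) \<notin> L" "(s, j0) \<in> L" | (mid) "(s, t) \<in> M"
      using st by (auto simp: M_def)
    then show ?thesis
    proof cases
      case col
      define Z where "Z = fps_X * fps_const (\<eta> t)"
      have "y t \<in> Q" using j0(3) pos col_less[OF col] by blast
      then have eq: "\<gamma> (x s * y t) = fps_X ^ 2 * (\<gamma> (x s) * fps_const Z)"
        using col by (simp add: \<gamma>D(4) \<gamma>y fy_def Z_def algebra_simps)
      have "fps_nth (\<gamma> (x s * y t)) 2 = fps_nth (\<gamma> (x s)) 0 * Z"
        unfolding eq by (simp add: fps_X_power_mult_nth)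
      moreover have "val (s, t) = fps_const (x s) * Z"
        using col by (simp add: val_def Z_def mult.commute mult.left_commute flip: fps_const_mult)
      ultimately have "fps_nth (\<gamma> (x s * y t)) 2 - val (s, t) = Z * (fps_nth (\<gamma> (x s)) 0 - fps_const (x s))"
        by (simp add: right_diff_distrib mult.commute)
      also have "\<dots> \<in> N" by (rule idl.subspace_scale[OF subN \<gamma>0])
      finally show ?thesis using eq by simp
    next
      case row
      define Z where "Z = fps_X * fps_const (\<xi> s)"
      have "x s \<in> Q" using i0(3) pos row_less[OF row(2)] by blast
      then have eq: "\<gamma> (x s * y t) = fps_X ^ 2 * (\<gamma> (y t) * fps_const Z)"
        using row by (simp add: \<gamma>D(4) \<gamma>x fx_def Z_def algebra_simps)
      have "fps_nth (\<gamma> (x s * y t)) 2 = fps_nth (\<gamma> (y t)) 0 * Z"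
        unfolding eq by (simp add: fps_X_power_mult_nth)
      moreover have "val (s, t) = fps_const (y t) * Z"
        using row by (simp add: val_def Z_def mult.commute mult.left_commute flip: fps_const_mult)
      ultimately have "fps_nth (\<gamma> (x s * y t)) 2 - val (s, t) = Z * (fps_nth (\<gamma> (y t)) 0 - fps_const (y t))"
        by (simp add: right_diff_distrib mult.commute)
      also have "\<dots> \<in> N" by (rule idl.subspace_scale[OF subN \<gamma>0])
      finally show ?thesis using eq by simp
    next
      case mid
      then have "x s \<in> Q" "y t \<in> Q" using i0(3) j0(3) pos M_less by blast+
      then have eq: "\<gamma> (x s * y t) = fps_X ^ 2 * fps_const (\<alpha> s * \<beta> t)"
        using mid by (simp add: \<gamma>D(4) \<gamma>x \<gamma>y fx_def fy_def M_def power2_eq_square algebra_simps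
          flip: fps_const_mult)
      then have "fps_nth (\<gamma> (x s * y t)) 2 - val (s, t) = 0"
        using mid by (simp add: fps_X_power_mult_nth val_def M_def)
      then show ?thesis using eq idl.subspace_0[OF subN] by simp
    qed
  qed

  \<comment> \<open>Leading coefficients of the diagonals and of J\<close>
  define T where "T k = fps_const (e k) + fps_X * fps_const (\<phi> (d k) - e k)" for k
  have D: "fps_nth (\<gamma> (d k)) 2 - T k \<in> N" for k
  proof -
    define C where "C = {c \<in> L. cell_diag c = k}"
    have finC: "finite C" using finL by (simp add: C_def)
    have "fps_nth (\<gamma> (d k)) 2 - sum val C
        = (\<Sum>c\<in>C. fps_nth (\<gamma> (case c of (s, t) \<Rightarrow> x s * y t)) 2 - val c)"
      by (simp add: d_def diag_sum_def C_def is_ring_hom_sum[OF \<gamma>] fps_sum_nth sum_subtractf)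
    also have "\<dots> \<in> N"
      by (rule idl.subspace_sum[OF subN]) (use cell in \<open>auto simp: C_def\<close>)
    finally have 1: "fps_nth (\<gamma> (d k)) 2 - sum val C \<in> N" .
    have 2: "sum val C - T k \<in> N"
    proof (cases "\<exists>c\<in>M. cell_diag c = k")
      case True
      then obtain s t where st: "(s, t) \<in> M" "cell_diag (s, t) = k" by auto
      have "sum val C = sum val (C - M) + sum val (C \<inter> M)"
        using finC by (metis add.commute sum.Int_Diff)
      also have "sum val (C \<inter> M) = diag_sum M \<alpha> \<beta> k"
        unfolding diag_sum_def by (rule sum.cong) (auto simp: C_def M_def val_def)
      also have "diag_sum M \<alpha> \<beta> k = T k"
        using \<alpha>\<beta>[OF st(1)] st by (auto simp: T_def e_def)
      finally have "sum val C - T k = sum val (C - M)" by simp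
      also have "\<dots> \<in> N"
      proof (rule idl.subspace_sum[OF subN])
        \<comment> \<open>Cells outside \<open>M\<close> on a diagonal that meets \<open>M\<close>
          contribute nothing: if t' belongs to row \<open>i0\<close>, then t' < t, so s' < s < i0 on
          the same diagonal and x_(s') lies in \<open>Q\<close>. The other case is
          symmetric.\<close>
        fix c assume c: "c \<in> C - M"
        obtain s' t' where st': "c = (s', t')" by (cases c)
        have L': "(s', t') \<in> L" using c st' by (simp add: C_def)
        have pos: "1 \<le> s'" "1 \<le> t'" using young_diagram_pos[OF L L'] by auto
        have diag: "int t' - int s' = int t - int s" using c st st' by (simp add: C_def cell_diag_def)
        have st_L: "(s, j0) \<notin> L" "(i0, t) \<notin> L" "1 \<le> s" "1 \<le> t"
          using st young_diagram_pos[OF L, of s t] by (auto simp: M_def)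
        consider (col) "(i0, t') \<in> L" | (row) "(i0, t') \<notin> L" "(s', j0) \<in> L"
          using c st' by (auto simp: M_def C_def)
        then show "val c \<in> N"
        proof cases
          case col
          have "\<not> t \<le> t'" using young_diagram_down[OF L col, of i0 t] i0 st_L by auto
          then have "s' < i0" using diag M_less[OF st(1)] by linarith
          then have "x s' \<in> Q" using i0(3) pos by blast
          then have "fps_const (x s' * \<eta> t') \<in> N"
            using idl.subspace_scale[OF subQ, of "x s'" "\<eta> t'"] by (simp add: constN mult.commute)
          then show ?thesis using col idl.subspace_scale[OF subN] by (simp add: st' val_def)
        next
          case row
          have "\<not> s \<le> s'" using young_diagram_down[OF L row(2), of s j0] j0 st_L by auto
          then have "t' < j0" using diag M_less[OF st(1)] by linarith
          then have "y t' \<in> Q" using j0(3) pos by blast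
          then have "fps_const (\<xi> s' * y t') \<in> N"
            using idl.subspace_scale[OF subQ, of "y t'" "\<xi> s'"] by (simp add: constN)
          then show ?thesis using row idl.subspace_scale[OF subN] by (simp add: st' val_def)
        qed
      qed
      finally show ?thesis .
    next
      case False
      have ek: "e k = 0"
      proof (rule ccontr)
        assume "e k \<noteq> 0"
        then have "M \<noteq> {}" "k = int b - int a" by (auto simp: e_def split: if_splits)
        then obtain s t where "(s, t) \<in> M" by auto
        then have "(a, b) \<in> M" using M_corner[of s t] M_down[of s t a b] by auto
        then show False using False \<open>k = _\<close> by (force simp: cell_diag_def)
      qed
      \<comment> \<open>Each cell of this diagonal contains a variable that \<open>u\<close>
        multiplies into \<open>J\<close>. There is no freedom left here: linearity of
        \<open>\<phi>\<close> shows that the values \<open>\<eta>\<close> and \<open>\<xi>\<close>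
        add up to the required coefficient.\<close>
      define col where "col c \<longleftrightarrow> (i0, snd c) \<in> L" for c :: "nat \<times> nat"
      define p where "p c = (if col c then x (fst c) else y (snd c))" for c
      define f where "f c = (if col c then u * y (snd c) else u * x (fst c))" for c
      have CM: "(fst c, j0) \<in> L" if "c \<in> C" "\<not> col c" for c
        using that False by (cases c) (auto simp: C_def M_def col_def)
      have fJ: "f c \<in> J" if "c \<in> C" for c
        using uy[of "snd c"] ux[of "fst c"] CM[OF that] by (auto simp: f_def col_def)
      have ud: "u * d k = (\<Sum>c\<in>C. p c * f c)"
        unfolding d_def diag_sum_def C_def sum_distrib_left
        by (rule sum.cong) (auto simp: p_def f_def algebra_simps)
      have "u * d k - (u * \<phi> (d k)) * d0 = u * (d k - \<phi> (d k) * d0)" by (simp add: algebra_simps)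
      also have "\<dots> \<in> K" by (rule idl.subspace_scale[OF K(1) \<phi>[OF dJ]])
      finally have "\<phi> (u * d k) - u * \<phi> (d k) \<in> Q"
        by (intro \<phi>_unique idl.subspace_scale[OF subJ dJ])
      moreover have "\<phi> (u * d k) - (\<Sum>c\<in>C. p c * \<phi> (f c)) \<in> Q"
        unfolding ud by (rule \<phi>_lin[OF fJ])
      ultimately have "(\<phi> (u * d k) - u * \<phi> (d k)) - (\<phi> (u * d k) - (\<Sum>c\<in>C. p c * \<phi> (f c))) \<in> Q"
        by (rule idl.subspace_diff[OF subQ])
      then have "(\<Sum>c\<in>C. p c * \<phi> (f c)) - u * \<phi> (d k) \<in> Q" by simp
      then have "w * ((\<Sum>c\<in>C. p c * \<phi> (f c)) - u * \<phi> (d k)) + \<phi> (d k) * (u * w - 1) \<in> Q"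
        by (intro idl.subspace_add[OF subQ] idl.subspace_scale[OF subQ] w)
      then have "(\<Sum>c\<in>C. w * (p c * \<phi> (f c))) - \<phi> (d k) \<in> Q"
        by (simp add: algebra_simps sum_distrib_left)
      then have "fps_X * fps_const ((\<Sum>c\<in>C. w * (p c * \<phi> (f c))) - \<phi> (d k)) \<in> N"
        by (intro idl.subspace_scale[OF subN] constN)
      moreover have "sum val C = fps_X * fps_const (\<Sum>c\<in>C. w * (p c * \<phi> (f c)))"
      proof -
        have "val c = fps_X * fps_const (w * (p c * \<phi> (f c)))" if "c \<in> C" for c
          using CM[OF that] by (cases c) (auto simp: val_def p_def f_def col_def \<eta>_def \<xi>_def ac_simps)
        then show ?thesis by (simp add: sum_distrib_left is_ring_hom_sum[OF fps_const_hom])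
      qed
      ultimately show ?thesis by (simp add: T_def ek algebra_simps flip: fps_const_sub)
    qed
    show ?thesis using idl.subspace_add[OF subN 1 2] by simp
  qed
  have dvd_gen: "fps_X ^ 2 dvd \<gamma> g" if "g \<in> G" for g
    using that cell by (auto simp: G_def gens_def)
  have dvd_pow: "fps_X ^ (2 * m) dvd \<gamma> f" if "f \<in> idl.span (pow_gens G m)" for f m
  proof -
    have "pow_gens G m \<subseteq> {f. fps_X ^ (2 * m) dvd \<gamma> f}"
    proof (induction m)
      case (Suc m)
      show ?case
      proof
        fix z assume "z \<in> pow_gens G (Suc m)"
        then obtain g h where "g \<in> G" "h \<in> pow_gens G m" "z = g * h" by (elim pow_gens_SucE)
        then show "z \<in> {f. fps_X ^ (2 * Suc m) dvd \<gamma> f}"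
          using fps_X_power_dvd_mult(1)[OF dvd_gen, of g "2 * m" "\<gamma> h"] Suc by (auto simp: \<gamma>D)
      qed
    qed simp
    moreover have "idl.subspace {f. fps_X ^ (2 * m) dvd \<gamma> f}"
      by (rule idl.subspaceI) (auto simp: \<gamma>D)
    ultimately show ?thesis using that idl.span_minimal by blast
  qed
  have spanG: "J \<subseteq> idl.span G"
    unfolding J_def by (rule idl.span_minimal) (auto simp: d_def G_def diag_sum_in_span_gens)
  have dvd_J: "fps_X ^ 2 dvd \<gamma> j" if "j \<in> J" for j
    using dvd_pow[of j 1] spanG that by (auto simp: pow_gens_1)
  \<comment> \<open>On \<open>K\<close> the first summand vanishes modulo \<open>N\<close>, and a
    multiple of 1 - tau remains.\<close>
  have J_lc: "\<exists>c. fps_nth (\<gamma> j) 2 - (fps_X * fps_const (\<phi> j) + (1 - fps_X) * fps_const c) \<in> N"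
    if "j \<in> J" for j
  proof -
    have "j \<in> J \<and> (\<exists>c. fps_nth (\<gamma> j) 2 - (fps_X * fps_const (\<phi> j) + (1 - fps_X) * fps_const c) \<in> N)"
      using that unfolding J_def
    proof (induction rule: idl.span_induct_alt)
      case base
      have "\<phi> 0 \<in> Q" using \<phi>_K idl.subspace_0[OF K(1)] by blast
      then have "- (fps_X * fps_const (\<phi> 0)) \<in> N"
        by (intro idl.subspace_neg[OF subN] idl.subspace_scale[OF subN] constN)
      then show ?case using idl.subspace_0[OF subJ]
        by (auto simp: \<gamma>D J_def intro!: exI[of _ 0])
    next
      case (step p z j)
      then obtain k c where z: "z = d k" and j: "j \<in> J"
        and c: "fps_nth (\<gamma> j) 2 - (fps_X * fps_const (\<phi> j) + (1 - fps_X) * fps_const c) \<in> N"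
        by (auto simp: J_def)
      have pz: "p * z + j \<in> J" using j dJ by (simp add: z idl.subspace_add[OF subJ] idl.subspace_scale[OF subJ])
      have "p * z + j - (p * \<phi> z + \<phi> j) * d0 = p * (z - \<phi> z * d0) + (j - \<phi> j * d0)"
        by (simp add: algebra_simps)
      also have "\<dots> \<in> K" unfolding z
        by (rule idl.subspace_add[OF K(1) idl.subspace_scale[OF K(1) \<phi>[OF dJ]] \<phi>[OF j]])
      finally have "\<phi> (p * z + j) - (p * \<phi> z + \<phi> j) \<in> Q" by (rule \<phi>_unique[OF pz])
      then have A: "fps_X * fps_const (\<phi> (p * z + j) - (p * \<phi> z + \<phi> j)) \<in> N"
        by (intro idl.subspace_scale[OF subN] constN)
      have lc: "fps_nth (\<gamma> (p * z + j)) 2 = fps_nth (\<gamma> p) 0 * fps_nth (\<gamma> z) 2 + fps_nth (\<gamma> j) 2"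
        using fps_nth_mult_dvd[OF dvd_J[OF dJ], of "\<gamma> p" k] by (simp add: \<gamma>D z)
      have B: "fps_nth (\<gamma> p) 0 * fps_nth (\<gamma> z) 2 - fps_const p * T k \<in> N"
        unfolding z by (rule idl_cong_mult[OF subN \<gamma>0 D])
      have Tk: "T k = fps_const (e k) + fps_X * (fps_const (\<phi> z) - fps_const (e k))"
        by (simp add: T_def z)
      have const: "fps_const (p * e k + c) = fps_const p * fps_const (e k) + fps_const c"
        "fps_const (\<phi> (p * z + j) - (p * \<phi> z + \<phi> j))
          = fps_const (\<phi> (p * z + j)) - (fps_const p * fps_const (\<phi> z) + fps_const (\<phi> j))"
        by simp_all
      have "fps_nth (\<gamma> (p * z + j)) 2
          - (fps_X * fps_const (\<phi> (p * z + j)) + (1 - fps_X) * fps_const (p * e k + c))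
        = (fps_nth (\<gamma> p) 0 * fps_nth (\<gamma> z) 2 - fps_const p * T k)
          + (fps_nth (\<gamma> j) 2 - (fps_X * fps_const (\<phi> j) + (1 - fps_X) * fps_const c))
          - fps_X * fps_const (\<phi> (p * z + j) - (p * \<phi> z + \<phi> j))"
        unfolding lc Tk const
        by (simp add: algebra_simps del: fps_const_add fps_const_sub fps_const_mult)
      also have "\<dots> \<in> N" by (intro idl.subspace_diff[OF subN idl.subspace_add[OF subN B c] A])
      finally show ?case using pz unfolding J_def by blast
    qed
    then show ?thesis by blast
  qed

  \<comment> \<open>Nakayama's lemma for the leading coefficients of I^r\<close>
  define H where "H = pow_gens G r"
  define v where "v h = fps_nth (\<gamma> h) (2 * r)" for h
  have finH: "finite H" unfolding H_def by (rule finite_pow_gens[OF finG])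
  have dvd_H: "fps_X ^ (2 * r) dvd \<gamma> h" if "h \<in> H" for h
    using that dvd_pow by (auto simp: H_def intro: idl.span_base)
  \<comment> \<open>The leading coefficient of \<open>d0\<close> as a polynomial in tau, where
    \<open>\<phi> d0\<close> is replaced by 1. Its value at tau = 1 is 1.\<close>
  define F0 where "F0 = [:e k0, 1 - e k0:]"
  have D0: "fps_nth (\<gamma> d0) 2 - fps_of_poly F0 \<in> N"
  proof -
    have A: "fps_X * fps_const (\<phi> d0 - 1) \<in> N" by (rule idl.subspace_scale[OF subN constN[OF \<phi>_d0]])
    have F0: "fps_of_poly F0 = fps_const (e k0) + fps_X * (1 - fps_const (e k0))"
      by (simp add: F0_def fps_of_poly_pCons flip: fps_const_sub)
    have Tk: "T k0 = fps_const (e k0) + fps_X * (fps_const (\<phi> d0) - fps_const (e k0))"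
      by (simp add: T_def k0)
    have const: "fps_const (\<phi> d0 - 1) = fps_const (\<phi> d0) - 1" by (simp flip: fps_const_sub)
    have "(fps_nth (\<gamma> (d k0)) 2 - T k0) + fps_X * fps_const (\<phi> d0 - 1) \<in> N"
      by (rule idl.subspace_add[OF subN D A])
    moreover have "(fps_nth (\<gamma> (d k0)) 2 - T k0) + fps_X * fps_const (\<phi> d0 - 1)
        = fps_nth (\<gamma> d0) 2 - fps_of_poly F0"
      unfolding F0 Tk const k0[symmetric] by (simp add: algebra_simps del: fps_const_sub)
    ultimately show ?thesis by simp
  qed
  (* At tau = 1 the leading coefficients of K vanish modulo Q, whereas that of d0 becomes 1, so that
     Nakayama's lemma applies to the prime of all polynomials in tau whose value at 1 lies in Q. *)
  have "\<exists>F. F \<notin> {F. poly F 1 \<in> Q} \<and> (\<forall>h\<in>H. fps_of_poly F * v h \<in> N)"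
  proof (rule nakayama_elimination[where act = fps_of_poly and N = N])
    show "\<forall>g\<in>H. \<exists>F h. F \<notin> {F. poly F 1 \<in> Q} \<and> (\<forall>l\<in>H. h l \<in> {F. poly F 1 \<in> Q}) \<and>
        fps_of_poly F * v g - (\<Sum>l\<in>H. fps_of_poly (h l) * v l) \<in> N"
    proof
      \<comment> \<open>The relation is obtained by writing \<open>d0 * g\<close>, an element of
        I^(r+1), with coefficients in \<open>K\<close> and comparing the coefficients of
        t^(2r+2).\<close>
      fix g assume g: "g \<in> H"
      have "d0 \<in> idl.span G" using spanG dJ k0 by blast
      moreover have "g \<in> idl.span H" using g by (rule idl.span_base)
      ultimately have "d0 * g \<in> idl.span (pow_gens G (Suc r))"
        by (rule span_times) (auto simp: H_def intro: idl.span_base pow_gens_SucI)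
      moreover have "idl.span (pow_gens G (Suc r)) \<subseteq> idl.span (prods K H)"
      proof (rule idl.span_minimal)
        have "prods J0 H \<subseteq> prods K H" using K(2) by (auto simp: prods_def)
        then show "pow_gens G (Suc r) \<subseteq> idl.span (prods K H)"
          using red idl.span_mono unfolding G_def H_def by blast
      qed simp
      ultimately obtain j where j: "\<And>h. j h \<in> K" "d0 * g = (\<Sum>h\<in>H. j h * h)"
        using subspace_finite_combination[OF K(1) finH] by blast
      have "\<exists>c. fps_nth (\<gamma> (j h)) 2 - (1 - fps_X) * fps_const c \<in> N" for h
      proof -
        obtain c where "fps_nth (\<gamma> (j h)) 2 - (fps_X * fps_const (\<phi> (j h)) + (1 - fps_X) * fps_const c) \<in> N"
          using J_lc[of "j h"] j(1) K(3) by blast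
        moreover have "fps_X * fps_const (\<phi> (j h)) \<in> N"
          using \<phi>_K[OF j(1)] by (intro idl.subspace_scale[OF subN] constN)
        ultimately have "fps_nth (\<gamma> (j h)) 2 - (fps_X * fps_const (\<phi> (j h)) + (1 - fps_X) * fps_const c)
            + fps_X * fps_const (\<phi> (j h)) \<in> N" by (rule idl.subspace_add[OF subN])
        then have "fps_nth (\<gamma> (j h)) 2 - (1 - fps_X) * fps_const c \<in> N" by simp
        then show ?thesis by blast
      qed
      then obtain c where c: "\<And>h. fps_nth (\<gamma> (j h)) 2 - (1 - fps_X) * fps_const (c h) \<in> N" by metis
      have lc: "fps_nth (\<gamma> (z * h)) (2 + 2 * r) = fps_nth (\<gamma> z) 2 * v h" if "z \<in> J" "h \<in> H" for z h
        using fps_X_power_dvd_mult(2)[OF dvd_J[OF that(1)] dvd_H[OF that(2)]] by (simp add: \<gamma>D v_def)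
      have "fps_nth (\<gamma> d0) 2 * v g = fps_nth (\<gamma> (\<Sum>h\<in>H. j h * h)) (2 + 2 * r)"
        using lc[of d0 g] g dJ j(2) by (simp add: k0)
      also have "\<dots> = (\<Sum>h\<in>H. fps_nth (\<gamma> (j h)) 2 * v h)"
        unfolding is_ring_hom_sum[OF \<gamma>] fps_sum_nth using lc j(1) K(3) by (intro sum.cong) auto
      finally have eq: "fps_nth (\<gamma> d0) 2 * v g = (\<Sum>h\<in>H. fps_nth (\<gamma> (j h)) 2 * v h)" .
      \<comment> \<open>The polynomial (1 - tau) c, which vanishes at tau = 1.\<close>
      define h where "h l = [:c l, - c l:]" for l
      have h: "fps_of_poly (h l) = (1 - fps_X) * fps_const (c l)" for l
        by (simp add: h_def fps_of_poly_pCons algebra_simps)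
      have "fps_of_poly F0 * v g - (\<Sum>l\<in>H. fps_of_poly (h l) * v l)
          = (\<Sum>l\<in>H. v l * (fps_nth (\<gamma> (j l)) 2 - (1 - fps_X) * fps_const (c l)))
            - v g * (fps_nth (\<gamma> d0) 2 - fps_of_poly F0)"
        using eq unfolding h
        by (simp add: right_diff_distrib left_diff_distrib sum_subtractf mult.commute)
      also have "\<dots> \<in> N"
        by (intro idl.subspace_diff[OF subN] idl.subspace_sum[OF subN] idl.subspace_scale[OF subN] c D0)
      finally have "fps_of_poly F0 * v g - (\<Sum>l\<in>H. fps_of_poly (h l) * v l) \<in> N" .
      moreover have "F0 \<notin> {F. poly F 1 \<in> Q}" using Q by (simp add: F0_def prime_idl_def)
      moreover have "h l \<in> {F. poly F 1 \<in> Q}" for l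
        using idl.subspace_0[OF subQ] by (simp add: h_def)
      ultimately show "\<exists>F h. F \<notin> {F. poly F 1 \<in> Q} \<and> (\<forall>l\<in>H. h l \<in> {F. poly F 1 \<in> Q}) \<and>
          fps_of_poly F * v g - (\<Sum>l\<in>H. fps_of_poly (h l) * v l) \<in> N" by blast
    qed
  qed (use finH prime_idl_eval_1[OF Q] subN in
      \<open>auto simp: fps_of_poly_add fps_of_poly_mult intro: idl.subspace_add idl.subspace_0 idl.subspace_scale\<close>)
  then obtain F where F: "poly F 1 \<notin> Q" "\<And>h. h \<in> H \<Longrightarrow> fps_of_poly F * v h \<in> N" by blast
  \<comment> \<open>Being nonzero modulo the prime \<open>N\<close>, the factor \<open>F\<close> can
    be cancelled, and all leading coefficients of I^r vanish.\<close>
  have "fps_of_poly F \<notin> N" using fps_of_poly_in_fps_idl[OF subQ] F(1) by (auto simp: N_def)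
  then have vN: "v h \<in> N" if "h \<in> H" for h using F(2)[OF that] prime_idl_mult[OF N] by blast
  have "fps_nth (\<gamma> f) (2 * r) \<in> N" if "f \<in> idl.span H" for f
    using that
  proof (induction rule: idl.span_induct_alt)
    case base
    then show ?case by (simp add: \<gamma>D idl.subspace_0[OF subN])
  next
    case (step c h f)
    have "fps_nth (\<gamma> (c * h)) (2 * r) = fps_nth (\<gamma> c) 0 * v h"
      using fps_nth_mult_dvd[OF dvd_H[OF step(1)], of "\<gamma> c"] by (simp add: \<gamma>D v_def)
    then show ?case
      using step vN by (simp add: \<gamma>D idl.subspace_add[OF subN] idl.subspace_scale[OF subN])
  qed
  \<comment> \<open>This power is the witness against it: its leading coefficient is
    \<open>F0 ^ r\<close> modulo \<open>N\<close>.\<close>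
  moreover have "d0 ^ r \<in> idl.span H"
    unfolding H_def by (rule power_in_span_pow_gens) (use spanG dJ k0 in blast)
  moreover have lc_pow: "fps_X ^ (2 * m) dvd \<gamma> (d0 ^ m) \<and> fps_nth (\<gamma> (d0 ^ m)) (2 * m) = fps_nth (\<gamma> d0) 2 ^ m" for m
  proof (induction m)
    case (Suc m)
    then show ?case
      using fps_X_power_dvd_mult[OF dvd_J[OF dJ[of k0]], of "2 * m" "\<gamma> (d0 ^ m)"] by (simp add: \<gamma>D k0)
  qed (simp add: \<gamma>D)
  ultimately have "fps_nth (\<gamma> d0) 2 ^ r \<in> N" by metis
  moreover have "fps_nth (\<gamma> d0) 2 \<notin> N"
  proof
    assume "fps_nth (\<gamma> d0) 2 \<in> N"
    then have "fps_nth (\<gamma> d0) 2 - (fps_nth (\<gamma> d0) 2 - fps_of_poly F0) \<in> N"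
      using D0 by (rule idl.subspace_diff[OF subN])
    then have "poly F0 1 \<in> Q" using fps_of_poly_in_fps_idl[OF subQ, of F0] by (simp add: N_def)
    then show False using Q by (simp add: F0_def prime_idl_def)
  qed
  ultimately show False using prime_idl_power[OF N] by blast
qed

subsection \<open>Ideals of a polynomial ring in fewer variables\<close>

text \<open>The type contains the polynomials in all variables, the theorem is about the subring in
  finitely many of them. Setting the others to 0 is a retraction onto this subring, and it allows
  ideals of the subring to be extended to the full ring and recovered by intersection.\<close>

locale ring_retraction =
  fixes \<rho> :: "'p::comm_ring_1 \<Rightarrow> 'p"
  assumes hom: "is_ring_hom \<rho>" and idem: "\<And>p. \<rho> (\<rho> p) = \<rho> p"
begin

definition C :: "'p set" where "C = {p. \<rho> p = p}"

definition R :: "'p ring" where "R = \<lparr>carrier = C, monoid.mult = (*), one = 1, zero = 0, add = (+)\<rparr>"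

lemmas homD = is_ring_homD[OF hom]

lemma R_simps [simp]:
  "carrier R = C" "monoid.mult R = (*)" "one R = 1" "zero R = 0" "add R = (+)"
  by (simp_all add: R_def)

lemma \<rho>_minus: "\<rho> (- p) = - \<rho> p"
  using homD(3)[of p "- p"] by (simp add: homD(1) eq_neg_iff_add_eq_0 add.commute)

lemma C_closed [simp]:
  "0 \<in> C" "1 \<in> C" "p \<in> C \<Longrightarrow> - p \<in> C" "p \<in> C \<Longrightarrow> q \<in> C \<Longrightarrow> p + q \<in> C"
  "p \<in> C \<Longrightarrow> q \<in> C \<Longrightarrow> p * q \<in> C" "\<rho> p \<in> C"
  by (simp_all add: C_def homD \<rho>_minus idem)

lemma sum_C: "(\<And>i. i \<in> A \<Longrightarrow> f i \<in> C) \<Longrightarrow> sum f A \<in> C"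
  by (induction A rule: infinite_finite_induct) simp_all

lemma cring_R: "cring R"
proof (rule cringI)
  show "abelian_group R"
    by (rule abelian_groupI) (auto simp: ac_simps intro!: bexI[of _ "- x" for x])
  show "comm_monoid R"
    by (rule comm_monoidI) (auto simp: ac_simps)
qed (auto simp: algebra_simps)

lemma ring_R: "ring R"
  using cring_R by (rule cring.axioms)

lemma idealI_R:
  assumes "A \<subseteq> C" "0 \<in> A" "\<And>p q. p \<in> A \<Longrightarrow> q \<in> A \<Longrightarrow> p + q \<in> A" "\<And>c p. c \<in> C \<Longrightarrow> p \<in> A \<Longrightarrow> c * p \<in> A"
  shows "ideal A R"
proof (rule idealI[OF ring_R])
  interpret ring R by (rule ring_R)
  show "subgroup A (add_monoid R)"
  proof (rule add.subgroupI)
    fix p assume p: "p \<in> A"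
    then have "- p \<in> A" using assms(4)[of "- 1" p] by simp
    moreover have "\<ominus>\<^bsub>R\<^esub> p = - p" using p assms(1) by (intro minus_equality) auto
    ultimately show "\<ominus>\<^bsub>R\<^esub> p \<in> A" by simp
  qed (use assms in auto)
next
  fix p c assume "p \<in> A" "c \<in> carrier R"
  then show "c \<otimes>\<^bsub>R\<^esub> p \<in> A" "p \<otimes>\<^bsub>R\<^esub> c \<in> A" using assms(4)[of c p] by (simp_all add: mult.commute)
qed

lemma ideal_RD:
  assumes "ideal A R"
  shows "A \<subseteq> C" "0 \<in> A" "p \<in> A \<Longrightarrow> q \<in> A \<Longrightarrow> p + q \<in> A" "c \<in> C \<Longrightarrow> p \<in> A \<Longrightarrow> c * p \<in> A"
proof -
  interpret ideal A R by (rule assms)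
  show "A \<subseteq> C" "0 \<in> A" using a_subset additive_subgroup.zero_closed[OF additive_subgroup_axioms] by simp_all
  show "p + q \<in> A" if "p \<in> A" "q \<in> A" using additive_subgroup.a_closed[OF additive_subgroup_axioms that] by simp
  show "c * p \<in> A" if "c \<in> C" "p \<in> A" using I_l_closed[of p c] that by simp
qed

text \<open>\<open>\<rho>\<close> moves the coefficients of a linear combination into the subring
  and fixes the elements of \<open>A\<close>.\<close>

lemma retract_span:
  assumes A: "ideal A R" and z: "z \<in> idl.span A"
  shows "\<rho> z \<in> A"
  using z
proof (induction rule: idl.span_induct_alt)
  case base
  then show ?case using ideal_RD[OF A] by (simp add: homD)
next
  case (step c a z)
  then have "\<rho> a = a" using ideal_RD(1)[OF A] by (auto simp: C_def)
  then show ?case using step ideal_RD(3,4)[OF A] by (simp add: homD)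
qed

lemma ideal_eq_span:
  assumes A: "ideal A R"
  shows "A = idl.span A \<inter> C"
proof
  show "A \<subseteq> idl.span A \<inter> C" using ideal_RD(1)[OF A] idl.span_superset by blast
  show "idl.span A \<inter> C \<subseteq> A" using retract_span[OF A] by (force simp: C_def)
qed

lemma ideal_span: "ideal (idl.span S \<inter> C) R"
  by (rule idealI_R) (auto simp: idl.span_zero idl.span_add idl.span_scale)

lemma genideal_eq_span:
  assumes "S \<subseteq> C"
  shows "genideal R S = idl.span S \<inter> C"
proof
  show "genideal R S \<subseteq> idl.span S \<inter> C"
    unfolding genideal_def using ideal_span[of S] idl.span_superset[of S] assms by blast
  show "idl.span S \<inter> C \<subseteq> genideal R S"
    unfolding genideal_def
  proof (intro subsetI InterI)
    fix z A assume z: "z \<in> idl.span S \<inter> C" and A: "A \<in> {A. ideal A R \<and> S \<subseteq> A}"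
    then have "z \<in> idl.span A" using idl.span_mono[of S A] by auto
    then have "\<rho> z \<in> A" using A retract_span by auto
    then show "z \<in> A" using z by (simp add: C_def)
  qed
qed

lemma prods_C: "A \<subseteq> C \<Longrightarrow> B \<subseteq> C \<Longrightarrow> prods A B \<subseteq> C"
  by (auto simp: prods_def intro!: C_closed(5))

lemma ideal_prod_eq_span:
  assumes "S \<subseteq> C" "P \<subseteq> C"
  shows "ideal_prod R (idl.span S \<inter> C) (idl.span P \<inter> C) = idl.span (prods S P) \<inter> C"
proof
  let ?A = "idl.span S \<inter> C" and ?B = "idl.span P \<inter> C"
  show "ideal_prod R ?A ?B \<subseteq> idl.span (prods S P) \<inter> C"
  proof
    fix z assume "z \<in> ideal_prod R ?A ?B"
    then show "z \<in> idl.span (prods S P) \<inter> C"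
    proof (induction rule: ideal_prod.induct)
      case (prod i j)
      then have "i * j \<in> idl.span (prods S P)"
        by (intro span_times[of i S j P]) (auto intro: idl.span_base prodsI)
      then show ?case using prod by simp
    next
      case (sum z1 z2)
      then show ?case by (simp add: idl.span_add)
    qed
  qed
  have "ideal (ideal_prod R ?A ?B) R"
    by (intro ring.ideal_prod_is_ideal ring_R ideal_span)
  moreover have "prods S P \<subseteq> ideal_prod R ?A ?B"
  proof
    fix z assume "z \<in> prods S P"
    then obtain a b where "a \<in> S" "b \<in> P" "z = a * b" by (auto simp: prods_def)
    then show "z \<in> ideal_prod R ?A ?B"
      using ideal_prod.prod[of a ?A b ?B R] assms by (auto intro: idl.span_base)
  qed
  ultimately show "idl.span (prods S P) \<inter> C \<subseteq> ideal_prod R ?A ?B"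
    using ideal_eq_span[of "ideal_prod R ?A ?B"] idl.span_mono by blast
qed

lemma pow_gens_C: "S \<subseteq> C \<Longrightarrow> pow_gens S n \<subseteq> C"
  by (induction n) (simp_all add: pow_gens_Suc prods_C)

lemma ideal_pow_eq_span:
  assumes "S \<subseteq> C"
  shows "ideal_pow R (idl.span S \<inter> C) n = idl.span (pow_gens S n) \<inter> C"
proof (induction n)
  case 0
  have "p \<in> idl.span {1}" for p :: 'p using idl.span_scale[OF idl.span_base, of 1 "{1}" p] by simp
  then show ?case by auto
next
  case (Suc n)
  then show ?case
    by (simp add: ideal_prod_eq_span[OF assms pow_gens_C[OF assms]] pow_gens_Suc)
qed

text \<open>The equation between ideals of the subring becomes an inclusion of generators in the
  full ring; the opposite inclusion holds because \<open>J\<close> lies in the ideal generated by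
  \<open>G\<close>.\<close>

lemma is_reduction_iff:
  assumes G: "G \<subseteq> C" and J: "ideal J R" "J \<subseteq> idl.span G"
  shows "is_reduction R J (idl.span G \<inter> C) \<longleftrightarrow>
    (\<exists>r. pow_gens G (Suc r) \<subseteq> idl.span (prods J (pow_gens G r)))"
proof -
  have JC: "J \<subseteq> C" using J ideal_RD by blast
  have "ideal_pow R (idl.span G \<inter> C) (Suc r) = ideal_prod R J (ideal_pow R (idl.span G \<inter> C) r) \<longleftrightarrow>
      pow_gens G (Suc r) \<subseteq> idl.span (prods J (pow_gens G r))" (is "?L = ?R \<longleftrightarrow> ?S") for r
  proof -
    have L: "?L = idl.span (pow_gens G (Suc r)) \<inter> C"
      by (rule ideal_pow_eq_span[OF G])
    have R: "?R = idl.span (prods J (pow_gens G r)) \<inter> C"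
      using ideal_prod_eq_span[OF JC pow_gens_C[OF G]] ideal_eq_span[OF J(1)]
      by (simp add: ideal_pow_eq_span[OF G])
    have sub: "prods J (pow_gens G r) \<subseteq> idl.span (pow_gens G (Suc r))"
    proof
      fix z assume "z \<in> prods J (pow_gens G r)"
      then obtain j h where z: "j \<in> J" "h \<in> pow_gens G r" "z = j * h" by (auto simp: prods_def)
      have "j * h \<in> idl.span (pow_gens G (Suc r))"
        by (rule span_times[of j G h "pow_gens G r"])
          (use z J in \<open>auto intro: idl.span_base pow_gens_SucI\<close>)
      then show "z \<in> idl.span (pow_gens G (Suc r))" using z by simp
    qed
    show ?thesis
    proof
      assume "?L = ?R"
      then show ?S
        unfolding L R using pow_gens_C[OF G, of "Suc r"] idl.span_superset by blast
    next
      assume ?S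
      then have "idl.span (pow_gens G (Suc r)) = idl.span (prods J (pow_gens G r))"
        using sub by (simp add: idl.span_eq)
      then show "?L = ?R" unfolding L R by simp
    qed
  qed
  then show ?thesis unfolding is_reduction_def using J JC by blast
qed

end

definition restrict_vars :: "'v set \<Rightarrow> (('v \<Rightarrow>\<^sub>0 nat) \<Rightarrow>\<^sub>0 'a::comm_ring_1) \<Rightarrow> (('v \<Rightarrow>\<^sub>0 nat) \<Rightarrow>\<^sub>0 'a)" where
  "restrict_vars V = poly_eval (Poly_Mapping.single 0) (\<lambda>v. if v \<in> V then var v else 0)"

lemma lookup_restrict_vars:
  "Poly_Mapping.lookup (restrict_vars V p) \<mu>
     = (if Poly_Mapping.keys \<mu> \<subseteq> V then Poly_Mapping.lookup p \<mu> else 0)"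
proof -
  let ?f = "\<lambda>v. if v \<in> V then var v else 0"
  have me: "monom_eval ?f \<nu> = (if Poly_Mapping.keys \<nu> \<subseteq> V then Poly_Mapping.single \<nu> 1 else 0)" for \<nu>
  proof (cases "Poly_Mapping.keys \<nu> \<subseteq> V")
    case True
    have "monom_eval ?f \<nu> = monom_eval var \<nu>"
      unfolding monom_eval_def by (rule prod.cong) (use True in auto)
    then show ?thesis using True by (simp add: monom_eval_var)
  next
    case False
    then obtain v where "v \<in> Poly_Mapping.keys \<nu>" "v \<notin> V" by blast
    then have "monom_eval ?f \<nu> = 0"
      unfolding monom_eval_def by (intro prod_zero bexI[of _ v]) (auto simp: in_keys_iff zero_power)
    then show ?thesis using False by simp
  qed
  have "restrict_vars V p
      = (\<Sum>\<nu>\<in>Poly_Mapping.keys p. if Poly_Mapping.keys \<nu> \<subseteq> V then Poly_Mapping.single \<nu> (Poly_Mapping.lookup p \<nu>) else 0)"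
    unfolding restrict_vars_def poly_eval_def me by (rule sum.cong) (auto simp: mult_single)
  also have "Poly_Mapping.lookup \<dots> \<mu> = (\<Sum>\<nu>\<in>Poly_Mapping.keys p.
      if \<nu> = \<mu> then (if Poly_Mapping.keys \<mu> \<subseteq> V then Poly_Mapping.lookup p \<mu> else 0) else 0)"
    unfolding lookup_sum by (rule sum.cong) (auto simp: lookup_single)
  also have "\<dots> = (if Poly_Mapping.keys \<mu> \<subseteq> V then Poly_Mapping.lookup p \<mu> else 0)"
    by (simp add: in_keys_iff)
  finally show ?thesis .
qed

lemma restrict_vars_retraction: "ring_retraction (restrict_vars V)"
proof
  show "is_ring_hom (restrict_vars V)"
    unfolding restrict_vars_def by (rule poly_eval_hom[OF is_ring_hom_single_0])
  show "restrict_vars V (restrict_vars V p) = restrict_vars V p" for p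
    by (rule poly_mapping_eqI) (simp add: lookup_restrict_vars)
qed

lemma restrict_vars_eq_iff:
  "restrict_vars V p = p \<longleftrightarrow> (\<forall>\<mu>\<in>Poly_Mapping.keys p. Poly_Mapping.keys \<mu> \<subseteq> V)"
proof
  assume eq: "restrict_vars V p = p"
  show "\<forall>\<mu>\<in>Poly_Mapping.keys p. Poly_Mapping.keys \<mu> \<subseteq> V"
  proof
    fix \<mu> assume "\<mu> \<in> Poly_Mapping.keys p"
    then have "Poly_Mapping.lookup (restrict_vars V p) \<mu> \<noteq> 0" by (simp add: eq in_keys_iff)
    then show "Poly_Mapping.keys \<mu> \<subseteq> V" by (simp add: lookup_restrict_vars split: if_splits)
  qed
next
  assume "\<forall>\<mu>\<in>Poly_Mapping.keys p. Poly_Mapping.keys \<mu> \<subseteq> V"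
  then show "restrict_vars V p = p"
    by (intro poly_mapping_eqI) (auto simp: lookup_restrict_vars in_keys_iff)
qed

lemma poly_ring_on_eq: "poly_ring_on V = ring_retraction.R (restrict_vars V)"
  unfolding poly_ring_on_def ring_retraction.R_def[OF restrict_vars_retraction]
    ring_retraction.C_def[OF restrict_vars_retraction] restrict_vars_eq_iff ..

lemma xy_eq: "xy i j = var (Inl i) * var (Inr j)"
  by (simp add: xy_def var_def mult_single)

subsection \<open>Ferrers diagrams\<close>

definition ferrers_diagram :: "nat list \<Rightarrow> (nat \<times> nat) set" where
  "ferrers_diagram lam = {(i, j). 1 \<le> i \<and> i \<le> length lam \<and> 1 \<le> j \<and> j \<le> part lam i}"

lemma gens_ferrers_diagram:
  "gens (ferrers_diagram lam) (\<lambda>i. var (Inl i)) (\<lambda>j. var (Inr j))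
     = {xy i j | i j. 1 \<le> i \<and> i \<le> length lam \<and> 1 \<le> j \<and> j \<le> part lam i}"
  unfolding gens_def ferrers_diagram_def xy_eq image_def by auto

lemma part_antimono:
  assumes "is_partition lam" "1 \<le> i'" "i' \<le> i" "i \<le> length lam"
  shows "part lam i \<le> part lam i'"
proof (cases "i' = i")
  case False
  then show ?thesis
    using assms sorted_wrt_nth_less[of "(\<ge>)" lam "i' - 1" "i - 1"]
    by (auto simp: is_partition_def Defs.part_def)
qed simp

lemma part_le_hd:
  assumes "is_partition lam" "1 \<le> i" "i \<le> length lam"
  shows "part lam i \<le> hd lam"
proof -
  have "lam \<noteq> []" using assms by (simp add: is_partition_def)
  then show ?thesis using part_antimono[OF assms(1) _ assms(2,3)] by (simp add: Defs.part_def hd_conv_nth)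
qed

lemma young_ferrers_diagram:
  assumes "is_partition lam"
  shows "young_diagram (ferrers_diagram lam)"
  unfolding young_diagram_def
proof (intro conjI allI impI)
  show "finite (ferrers_diagram lam)"
  proof (rule finite_subset)
    have "j \<le> hd lam" if "1 \<le> i" "i \<le> length lam" "j \<le> part lam i" for i j
      using part_le_hd[OF assms that(1,2)] that(3) by linarith
    then show "ferrers_diagram lam \<subseteq> {1..length lam} \<times> {1..hd lam}"
      by (auto simp: ferrers_diagram_def)
  qed simp
next
  fix i j i' j' assume "(i, j) \<in> ferrers_diagram lam" "1 \<le> i'" "i' \<le> i" "1 \<le> j'" "j' \<le> j"
  then show "(i', j') \<in> ferrers_diagram lam"
    using part_antimono[OF assms, of i' i] by (auto simp: ferrers_diagram_def)
qed (auto simp: ferrers_diagram_def)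

text \<open>Integers whose diagonal has no cell account for the additional 0, which does not change
  the ideal.\<close>

lemma ferrers_diagonals_span:
  fixes lam :: "nat list"
  assumes lam: "is_partition lam"
  defines "d \<equiv> diag_sum (ferrers_diagram lam) (\<lambda>i. var (Inl i)) (\<lambda>j. var (Inr j))
             :: int \<Rightarrow> (((nat + nat) \<Rightarrow>\<^sub>0 nat) \<Rightarrow>\<^sub>0 'a::comm_ring_1)"
  shows "ferrers_diagonals lam \<subseteq> range d" "range d \<subseteq> insert 0 (ferrers_diagonals lam)"
proof -
  have pos: "(\<Sum>i\<in>{i. 1 \<le> i \<and> i \<le> length lam \<and> k + i \<le> part lam i}. xy i (k + i)) = d (int k)" for k
    unfolding d_def diag_sum_def
    by (rule sum.reindex_bij_witness[of _ fst "\<lambda>i. (i, k + i)"])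
      (auto simp: ferrers_diagram_def cell_diag_def xy_eq)
  have neg: "(\<Sum>i\<in>{i. 1 \<le> i \<and> k + i \<le> length lam \<and> i \<le> part lam (k + i)}. xy (k + i) i) = d (- int k)" for k
    unfolding d_def diag_sum_def
  proof (rule sum.reindex_bij_witness[of _ snd "\<lambda>i. (k + i, i)"])
    fix c assume c: "c \<in> {c \<in> ferrers_diagram lam. cell_diag c = - int k}"
    then have "fst c = k + snd c" by (auto simp: cell_diag_def)
    then show "(k + snd c, snd c) = c"
      "snd c \<in> {i. 1 \<le> i \<and> k + i \<le> length lam \<and> i \<le> part lam (k + i)}"
      using c by (auto simp: ferrers_diagram_def prod_eq_iff)
  qed (auto simp: ferrers_diagram_def cell_diag_def xy_eq)
  have diagonals: "ferrers_diagonals lam = {d (int k) | k. k \<le> hd lam - 1}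
      \<union> {d (- int k) | k. 1 \<le> k \<and> k \<le> length lam - 1}"
    unfolding ferrers_diagonals_def pos neg ..
  show "ferrers_diagonals lam \<subseteq> range d" unfolding diagonals by blast
  show "range d \<subseteq> insert 0 (ferrers_diagonals lam)"
  proof
    fix z assume "z \<in> range d"
    then obtain k where z: "z = d k" by blast
    show "z \<in> insert 0 (ferrers_diagonals lam)"
    proof (cases "\<exists>c \<in> ferrers_diagram lam. cell_diag c = k")
      case True
      then obtain i j where ij: "(i, j) \<in> ferrers_diagram lam" "k = int j - int i"
        by (auto simp: cell_diag_def)
      have "1 \<le> i" "i \<le> length lam" "1 \<le> j" "j \<le> hd lam"
        using ij part_le_hd[OF lam, of i] by (auto simp: ferrers_diagram_def)
      note bounds = this
      show ?thesis
      proof (cases "0 \<le> k")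
        case True
        then have "nat k \<le> hd lam - 1" "z = d (int (nat k))" using bounds ij z by auto
        then show ?thesis unfolding diagonals by blast
      next
        case False
        then have "1 \<le> nat (- k)" "nat (- k) \<le> length lam - 1" "z = d (- int (nat (- k)))"
          using bounds ij z by auto
        then show ?thesis unfolding diagonals by blast
      qed
    next
      case False
      then have none: "{c \<in> ferrers_diagram lam. cell_diag c = k} = {}" by blast
      have "d k = 0" unfolding d_def diag_sum_def none by simp
      then show ?thesis by (simp add: z)
    qed
  qed
qed

theorem theorem5p1:
  fixes lam :: "nat list"
  assumes "is_partition lam"
  shows "is_minimal_reduction (ferrers_ring lam :: ((((nat + nat) \<Rightarrow>\<^sub>0 nat) \<Rightarrow>\<^sub>0 'a::field) ring))
           (diagonal_ideal lam) (ferrers_ideal lam)"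
proof -
  define V :: "(nat + nat) set" where "V = Inl ` {1..length lam} \<union> Inr ` {1..hd lam}"
  define \<rho> :: "(((nat + nat) \<Rightarrow>\<^sub>0 nat) \<Rightarrow>\<^sub>0 'a) \<Rightarrow> _" where "\<rho> = restrict_vars V"
  interpret ring_retraction \<rho> unfolding \<rho>_def by (rule restrict_vars_retraction)
  define x where "x = (\<lambda>i. var (Inl i) :: ((nat + nat) \<Rightarrow>\<^sub>0 nat) \<Rightarrow>\<^sub>0 'a)"
  define y where "y = (\<lambda>j. var (Inr j) :: ((nat + nat) \<Rightarrow>\<^sub>0 nat) \<Rightarrow>\<^sub>0 'a)"
  define L where "L = ferrers_diagram lam"
  define G where "G = gens L x y"
  define d where "d = diag_sum L x y"
  define D where "D = (ferrers_diagonals lam :: (((nat + nat) \<Rightarrow>\<^sub>0 nat) \<Rightarrow>\<^sub>0 'a) set)"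
  define I where "I = idl.span G \<inter> C"
  define J where "J = idl.span D \<inter> C"
  have L: "young_diagram L" unfolding L_def by (rule young_ferrers_diagram[OF assms])
  have ring: "ferrers_ring lam = R"
    unfolding ferrers_ring_def V_def[symmetric] \<rho>_def poly_ring_on_eq ..
  have D: "D \<subseteq> range d" "range d \<subseteq> insert 0 D"
    using ferrers_diagonals_span[OF assms] by (auto simp: D_def d_def L_def x_def y_def)
  have insert_D: "insert 0 D \<subseteq> idl.span D"
    using idl.span_superset[of D] idl.span_zero[of D] by simp
  have span_D: "idl.span D = idl.span (range d)"
    unfolding idl.span_eq
    using order_trans[OF D(1) idl.span_superset] order_trans[OF D(2) insert_D] by simp
  have dG: "range d \<subseteq> idl.span G" by (auto simp: d_def G_def diag_sum_in_span_gens)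
  have var_C: "var v \<in> C" if "v \<in> V" for v
  proof -
    have "\<rho> (var v) = var v"
      using that by (simp add: \<rho>_def restrict_vars_def poly_eval_var[OF is_ring_hom_single_0])
    then show ?thesis unfolding C_def by simp
  qed
  have cell_C: "x i * y j \<in> C" if "(i, j) \<in> L" for i j
  proof -
    have ij: "1 \<le> i" "i \<le> length lam" "1 \<le> j" "j \<le> part lam i"
      using that unfolding L_def ferrers_diagram_def by simp_all
    then have "j \<le> hd lam" using part_le_hd[OF assms, of i] by simp
    then have "Inl i \<in> V" "Inr j \<in> V" using ij unfolding V_def by simp_all
    then show ?thesis unfolding x_def y_def by (intro C_closed(5) var_C)
  qed
  have cell_C': "(case c of (i, j) \<Rightarrow> x i * y j) \<in> C" if "c \<in> L" for c
    using cell_C[of "fst c" "snd c"] that by (simp add: case_prod_beta)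
  have GC: "G \<subseteq> C"
    unfolding G_def gens_def by (rule image_subsetI) (rule cell_C')
  have "d k \<in> C" for k
    unfolding d_def diag_sum_def by (rule sum_C) (rule cell_C', simp)
  then have dC: "range d \<subseteq> C" by blast
  then have DC: "D \<subseteq> C" using D(1) by simp
  have gens: "{xy i j | i j. 1 \<le> i \<and> i \<le> length lam \<and> 1 \<le> j \<and> j \<le> part lam i} = G"
    unfolding G_def L_def x_def y_def by (rule gens_ferrers_diagram[symmetric])
  have I: "ferrers_ideal lam = I"
    unfolding ferrers_ideal_def ring I_def gens by (rule genideal_eq_span[OF GC])
  have J: "diagonal_ideal lam = J"
    unfolding diagonal_ideal_def ring J_def D_def[symmetric] by (rule genideal_eq_span[OF DC])
  have JG: "J \<subseteq> idl.span G"
    unfolding J_def span_D using idl.span_minimal[OF dG idl.subspace_span] by blast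
  have idealJ: "ideal J R" unfolding J_def by (rule ideal_span)
  obtain r where r: "pow_gens G (Suc r) \<subseteq> idl.span (prods (range d) (pow_gens G r))"
    using diagonals_reduction[OF L] unfolding G_def d_def by blast
  have "range d \<subseteq> J" using dC order_trans[OF D(2) insert_D] unfolding J_def by simp
  then have "prods (range d) (pow_gens G r) \<subseteq> prods J (pow_gens G r)" by (rule prods_mono)
  then have "is_reduction R J I"
    unfolding I_def is_reduction_iff[OF GC idealJ JG] using r idl.span_mono by blast
  moreover have "J \<subseteq> J'" if J': "J' \<subseteq> J" "is_reduction R J' I" for J'
  proof -
    have idealJ': "ideal J' R" using J' by (simp add: is_reduction_def)
    obtain r where r: "pow_gens G (Suc r) \<subseteq> idl.span (prods J' (pow_gens G r))"
      using J' JG is_reduction_iff[OF GC idealJ'] unfolding I_def by blast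
    \<comment> \<open>\<open>J'\<close> is extended to the full ring, where
      \<open>diag_sum_no_proper_reduction\<close> applies; intersecting with \<open>C\<close>
      afterwards gives \<open>J'\<close> back.\<close>
    have "prods J' (pow_gens G r) \<subseteq> prods (idl.span J') (pow_gens G r)"
      by (rule prods_mono[OF idl.span_superset])
    then have "pow_gens G (Suc r) \<subseteq> idl.span (prods (idl.span J') (pow_gens G r))"
      using r idl.span_mono by blast
    moreover have "idl.span J' \<subseteq> idl.span (range d)"
      using J'(1) unfolding J_def span_D by (intro idl.span_minimal idl.subspace_span) blast
    ultimately have "idl.span (range d) \<subseteq> idl.span J'"
      using diag_sum_no_proper_reduction[OF L idl.subspace_span, of J' r]
      unfolding G_def d_def x_def y_def by blast
    then show ?thesis using ideal_eq_span[OF idealJ'] unfolding J_def span_D by blast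
  qed
  ultimately show ?thesis
    unfolding is_minimal_reduction_def ring I J by blast
qed

end
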